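(* Let $n\ge 2$. The dihedral angles of labelled $n$-simplexes in the classical geometries $\mathbb S^n$, $\mathbb E^n$, $\mathbb H^n$ compare as follows. (M1) For every $\mathbb S^n$-simplex $\mathcal S$, there is an $\mathbb E^n$-simplex $\mathcal E$ such that $\mathcal E\prec\mathcal S$. (M2) For every $\mathbb H^n$-simplex $\mathcal H$, there is an $\mathbb E^n$-simplex $\mathcal E$ such that $\mathcal H\prec\mathcal E$. (M3) For every $\mathbb E^n$-simplex $\mathcal E$, there are an $\mathbb S^n$-simplex $\mathcal S$ and an $\mathbb H^n$-simplex $\mathcal H$ such that $\mathcal H\prec\mathcal E\prec\mathcal S$. (M4) If $\mathcal E_1,\mathcal E_2$ are $\mathbb E^n$-simplexes such that $\mathcal E_1\preceq\mathcal E_2$, then $\mathcal E_1$ and $\mathcal E_2$ have exactly the same corresponding dihedral angles.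
   Context: Let $\mathbb K^n$ denote one of the unit $n$-sphere $\mathbb S^n$, Euclidean $n$-space $\mathbb E^n$, or hyperbolic $n$-space $\mathbb H^n$. A $\mathbb K^n$-simplex $\mathcal Z=(z_1,\dots,z_{n+1})$ is the geodesic convex hull of $n+1$ points $z_1,\dots,z_{n+1}\in\mathbb K^n$ (its vertices) not lying in any $(n-1)$-dimensional totally geodesic submanifold; vertices are labelled (for $\mathbb S^n$ this means that the $z_i$ are linearly independent unit vectors in $\mathbb R^{n+1}$). $F_i(\mathcal Z)$ is the codimension-1 face opposite to $z_i$, and for $i\neq j$ the dihedral angle $\zeta_{ij}\in(0,\pi)$ of $\mathcal Z$ is the interior angle between the faces $F_i(\mathcal Z)$ and $F_j(\mathcal Z)$. Given two simplexes $\mathcal S,\mathcal T$ of the same dimension $n$ (possibly in different geometries) with dihedral angles $\sigma_{ij}$ and $\tau_{ij}$, write $\mathcal S\preceq\mathcal T$ if $\sigma_{ij}\le\tau_{ij}$ for all $i\ne j$, and $\mathcal S\prec\mathcal T$ if $\mathcal S\preceq\mathcal T$ and $\sigma_{ij}<\tau_{ij}$ for at least one pair $i\neq j$. *)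

theory Defs
  imports "HOL-Analysis.Analysis"
begin

text \<open>
  Throughout, \<open>n = CARD('n)\<close>. Euclidean \<open>n\<close>-space is \<open>real^'n\<close>. The sphere and hyperbolic space
  (hyperboloid model) both live in the \<open>(n+1)\<close>-dimensional space \<open>(real^'n) \<times> real\<close>, equipped with
  the library's inner product and with the Lorentz form, respectively.
  A labelled simplex is given by its vertices \<open>z 1, \<dots>, z (n+1)\<close>; other values of \<open>z\<close> are irrelevant.
\<close>

definition lorentz :: "(real^'n) \<times> real \<Rightarrow> (real^'n) \<times> real \<Rightarrow> real" where
  "lorentz p q = fst p \<bullet> fst q - snd p * snd q"

definition unit_sphere :: "((real^'n) \<times> real) set" where
  "unit_sphere = sphere 0 1"

definition hyperbolic_space :: "((real^'n) \<times> real) set" where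
  "hyperbolic_space = {p. lorentz p p = -1 \<and> snd p > 0}"


text \<open>
  Complete \<open>(n-1)\<close>-dimensional totally geodesic submanifolds. In the hyperboloid model these are the
  sections of the hyperboloid by linear hyperplanes with spacelike normal.
\<close>

definition euclidean_hyperplane :: "(real^'n) set \<Rightarrow> bool" where
  "euclidean_hyperplane P \<longleftrightarrow> (\<exists>a b. a \<noteq> 0 \<and> P = {x. a \<bullet> x = b})"

definition hyperbolic_hyperplane :: "((real^'n) \<times> real) set \<Rightarrow> bool" where
  "hyperbolic_hyperplane P \<longleftrightarrow>
     (\<exists>a. lorentz a a > 0 \<and> P = {x \<in> hyperbolic_space. lorentz a x = 0})"

definition euclidean_simplex :: "(nat \<Rightarrow> real^'n) \<Rightarrow> bool" where
  "euclidean_simplex z \<longleftrightarrow>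
     \<not> (\<exists>P. euclidean_hyperplane P \<and> z ` {1..CARD('n) + 1} \<subseteq> P)"

definition spherical_simplex :: "(nat \<Rightarrow> (real^'n) \<times> real) \<Rightarrow> bool" where
  "spherical_simplex z \<longleftrightarrow>
     z ` {1..CARD('n) + 1} \<subseteq> unit_sphere \<and>
     inj_on z {1..CARD('n) + 1} \<and> independent (z ` {1..CARD('n) + 1})"

definition hyperbolic_simplex :: "(nat \<Rightarrow> (real^'n) \<times> real) \<Rightarrow> bool" where
  "hyperbolic_simplex z \<longleftrightarrow>
     z ` {1..CARD('n) + 1} \<subseteq> hyperbolic_space \<and>
     \<not> (\<exists>P. hyperbolic_hyperplane P \<and> z ` {1..CARD('n) + 1} \<subseteq> P)"


text \<open>
  The dihedral angle at the ridge \<open>F\<^sub>i \<inter> F\<^sub>j\<close>, whose vertices are the \<open>z k\<close> with \<open>k \<noteq> i, j\<close>, is the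
  angle between the two directions that are orthogonal to the ridge and point from it into \<open>F\<^sub>j\<close>
  and into \<open>F\<^sub>i\<close>. As \<open>F\<^sub>j\<close> is spanned by the ridge and \<open>z i\<close>, the first is the component of \<open>z i\<close>
  orthogonal to the ridge; likewise the second, with \<open>z j\<close>. In the two linear models the component
  orthogonal to the linear span of the ridge is orthogonal to every point \<open>p\<close> of the ridge, hence
  tangent to the space at \<open>p\<close>, and the metric on tangent spaces is the restriction of the ambient
  form. For nondegenerate simplexes the described vectors exist uniquely and the form is positive
  on them.
\<close>

definition ridge_vertices :: "nat \<Rightarrow> (nat \<Rightarrow> 'a) \<Rightarrow> nat \<Rightarrow> nat \<Rightarrow> 'a set" where
  "ridge_vertices n z i j = z ` ({1..n + 1} - {i, j})"

definition angle_wrt :: "('a \<Rightarrow> 'a \<Rightarrow> real) \<Rightarrow> 'a \<Rightarrow> 'a \<Rightarrow> real" where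
  "angle_wrt B u v = arccos (B u v / (sqrt (B u u) * sqrt (B v v)))"

definition affine_normal_part :: "'a::real_inner set \<Rightarrow> 'a \<Rightarrow> 'a" where
  "affine_normal_part R x =
     (THE v. x - v \<in> affine hull R \<and> (\<forall>r\<in>R. \<forall>s\<in>R. v \<bullet> (r - s) = 0))"

definition linear_normal_part :: "('a::real_vector \<Rightarrow> 'a \<Rightarrow> real) \<Rightarrow> 'a set \<Rightarrow> 'a \<Rightarrow> 'a" where
  "linear_normal_part B R x = (THE v. x - v \<in> span R \<and> (\<forall>r\<in>R. B v r = 0))"

definition euclidean_dihedral :: "(nat \<Rightarrow> real^'n) \<Rightarrow> nat \<Rightarrow> nat \<Rightarrow> real" where
  "euclidean_dihedral z i j =
     (let R = ridge_vertices CARD('n) z i j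
      in angle_wrt inner (affine_normal_part R (z i)) (affine_normal_part R (z j)))"

definition spherical_dihedral :: "(nat \<Rightarrow> (real^'n) \<times> real) \<Rightarrow> nat \<Rightarrow> nat \<Rightarrow> real" where
  "spherical_dihedral z i j =
     (let R = ridge_vertices CARD('n) z i j
      in angle_wrt inner (linear_normal_part inner R (z i)) (linear_normal_part inner R (z j)))"

definition hyperbolic_dihedral :: "(nat \<Rightarrow> (real^'n) \<times> real) \<Rightarrow> nat \<Rightarrow> nat \<Rightarrow> real" where
  "hyperbolic_dihedral z i j =
     (let R = ridge_vertices CARD('n) z i j
      in angle_wrt lorentz (linear_normal_part lorentz R (z i)) (linear_normal_part lorentz R (z j)))"


text \<open>
  The relations \<open>\<preceq>\<close> and \<open>\<prec>\<close> compare simplexes of possibly different geometries, so they are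
  stated on the families of dihedral angles of two \<open>n\<close>-simplexes.
\<close>

definition angles_le :: "nat \<Rightarrow> (nat \<Rightarrow> nat \<Rightarrow> real) \<Rightarrow> (nat \<Rightarrow> nat \<Rightarrow> real) \<Rightarrow> bool" where
  "angles_le n \<sigma> \<tau> \<longleftrightarrow> (\<forall>i\<in>{1..n + 1}. \<forall>j\<in>{1..n + 1}. i \<noteq> j \<longrightarrow> \<sigma> i j \<le> \<tau> i j)"

definition angles_less :: "nat \<Rightarrow> (nat \<Rightarrow> nat \<Rightarrow> real) \<Rightarrow> (nat \<Rightarrow> nat \<Rightarrow> real) \<Rightarrow> bool" where
  "angles_less n \<sigma> \<tau> \<longleftrightarrow> angles_le n \<sigma> \<tau> \<and>
     (\<exists>i\<in>{1..n + 1}. \<exists>j\<in>{1..n + 1}. i \<noteq> j \<and> \<sigma> i j < \<tau> i j)"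

end

theory Submission
  imports Defs
begin

text \<open>
  In each geometry a simplex is described by inward normals \<open>u\<^sub>i\<close> of its facets, and the cosine of its
  dihedral angle at \<open>i, j\<close> is minus the normalized product of \<open>u\<^sub>i\<close> and \<open>u\<^sub>j\<close>. Angles therefore grow
  with the entries of the Gram matrix \<open>G\<close> of the unit normals, and the four claims become statements
  about matrices with unit diagonal. Such a matrix belongs to a spherical simplex if it is positive
  definite, and to a Euclidean one if it is positive semidefinite with kernel spanned by a positive
  vector (\<open>euclidean_realization\<close>).

  Rigidity of Euclidean angles: if \<open>G \<le> G'\<close> are Euclidean and \<open>G' c = 0\<close> with \<open>c > 0\<close> (Minkowski's
  relation for the facet areas), then \<open>0 \<le> c\<^sup>T G c \<le> c\<^sup>T G' c = 0\<close>, so all entries agree.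

  Between Euclidean and curved: place the incenter of a Euclidean simplex of inradius \<open>r\<close> at the origin
  and read its vertices in the gnomonic chart of the sphere or, after shrinking by \<open>t\<close>, in the Klein
  ball. All facets are at the same distance from the origin, so \<open>G\<close> turns into
  \<open>(G + r\<^sup>2 J) / (1 + r\<^sup>2)\<close> and into \<open>(G - t\<^sup>2 r\<^sup>2 J) / (1 - t\<^sup>2 r\<^sup>2)\<close>, where \<open>J\<close> is the all-ones
  matrix; since \<open>G\<close> has entries below 1 off the diagonal, the first is larger and the second smaller
  than \<open>G\<close>. Conversely a hyperbolic simplex has an incenter direction \<open>w\<close>, a positive combination of
  its vertices and hence timelike, and projecting the unit normals to the spacelike complement of
  \<open>w\<close> produces the Euclidean matrix \<open>(G + s J) / (1 + s)\<close> for some \<open>s > 0\<close>.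

  The spherical simplex is the hard case, because projecting along its incenter need not leave a
  compact simplex. Instead the unit normals \<open>u\<^sub>i\<close> are moved by a Moebius transformation of the sphere.
  Regard the unit ball as the Klein model, choose a point \<open>w = \<Sum>\<^sub>i y\<^sub>i u\<^sub>i\<close> with all \<open>y\<^sub>i > 0\<close>
  and \<open>\<Sum>\<^sub>i y\<^sub>i = 1\<close>, and let a hyperbolic isometry carry \<open>w\<close> to the center. The images of the
  \<open>u\<^sub>i\<close> then have the center in the interior of their simplex, so they are normals of a Euclidean
  simplex, and with \<open>\<nu>\<^sub>i = 1 - w \<bullet> u\<^sub>i\<close> their products are
  \<open>1 - (1 - \<parallel>w\<parallel>\<^sup>2) (1 - G\<^sub>i\<^sub>j) / (\<nu>\<^sub>i \<nu>\<^sub>j)\<close>. They lie below \<open>G\<^sub>i\<^sub>j\<close> as soon as \<open>\<nu>\<^sub>i\<^sup>2 < 1 - \<parallel>w\<parallel>\<^sup>2\<close> for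
  all \<open>i\<close>. The point of the convex hull of the \<open>u\<^sub>i\<close> nearest to the origin satisfies this, and so does
  every interior point close to it (\<open>exists_moebius_center\<close>).
\<close>

section \<open>Facet normals and dual bases\<close>

text \<open>
  Two vector spaces are paired so that the three geometries can be treated alike: the linear models use
  their own form, and a Euclidean point \<open>z\<close> enters as \<open>(z, 1)\<close>, so that a half space
  \<open>u \<bullet> z + b \<ge> 0\<close> becomes a vector \<open>(u, b)\<close>. Up to positive factors, \<open>U\<close> is then the dual basis
  of \<open>Z\<close>.
\<close>

definition facet_normals ::
    "('a \<Rightarrow> 'b \<Rightarrow> real) \<Rightarrow> 'i set \<Rightarrow> ('i \<Rightarrow> 'a) \<Rightarrow> ('i \<Rightarrow> 'b) \<Rightarrow> bool" where
  "facet_normals B I U Z \<longleftrightarrow>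
     (\<forall>i\<in>I. B (U i) (Z i) > 0) \<and> (\<forall>i\<in>I. \<forall>k\<in>I. i \<noteq> k \<longrightarrow> B (U i) (Z k) = 0)"

definition cosine_wrt :: "('a \<Rightarrow> 'a \<Rightarrow> real) \<Rightarrow> 'a \<Rightarrow> 'a \<Rightarrow> real" where
  "cosine_wrt B u v = B u v / (sqrt (B u u) * sqrt (B v v))"

lemma facet_normals_pos: "facet_normals B I U Z \<Longrightarrow> i \<in> I \<Longrightarrow> B (U i) (Z i) > 0"
  by (simp add: facet_normals_def)

lemma facet_normals_zero:
  "facet_normals B I U Z \<Longrightarrow> i \<in> I \<Longrightarrow> k \<in> I \<Longrightarrow> i \<noteq> k \<Longrightarrow> B (U i) (Z k) = 0"
  by (simp add: facet_normals_def)

lemma facet_normals_ridge: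
  "facet_normals B I U Z \<Longrightarrow> i \<in> I \<Longrightarrow> j \<in> I \<Longrightarrow> l \<in> {i, j} \<Longrightarrow> z \<in> Z ` (I - {i, j})
    \<Longrightarrow> B (U l) z = 0"
  unfolding facet_normals_def by auto

lemma facet_normals_sym:
  assumes "facet_normals B I U Z" and "\<And>x y. B x y = B y x"
  shows "facet_normals B I Z U"
  using assms unfolding facet_normals_def by metis

lemma facet_normals_scale:
  assumes "bilinear B" "facet_normals B I U Z"
    and "\<And>i. i \<in> I \<Longrightarrow> a i > 0" "\<And>i. i \<in> I \<Longrightarrow> b i > 0"
  shows "facet_normals B I (\<lambda>i. a i *\<^sub>R U i) (\<lambda>i. b i *\<^sub>R Z i)"
  using assms unfolding facet_normals_def
  by (simp add: bilinear_lmul bilinear_rmul)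

lemma bilinear_sum_left:
  assumes "bilinear B"
  shows "B (\<Sum>i\<in>I. x i *\<^sub>R u i) y = (\<Sum>i\<in>I. x i * (B (u i) y :: real))"
proof -
  interpret linear "\<lambda>x. B x y" using assms by (simp add: bilinear_def)
  show ?thesis by (simp add: sum scaleR)
qed

lemma bilinear_sum_right:
  assumes "bilinear B"
  shows "B y (\<Sum>i\<in>I. x i *\<^sub>R u i) = (\<Sum>i\<in>I. x i * (B y (u i) :: real))"
proof -
  interpret linear "B y" using assms by (simp add: bilinear_def)
  show ?thesis by (simp add: sum scaleR)
qed

lemma bilinear_inner: "bilinear (inner :: 'a::real_inner \<Rightarrow> 'a \<Rightarrow> real)"
  by (auto simp: bilinear_def linear_iff inner_add inner_left_distrib inner_right_distrib)

lemma facet_normals_combination: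
  assumes "bilinear B" "finite I" "facet_normals B I U Z" "k \<in> I"
  shows "B (\<Sum>i\<in>I. x i *\<^sub>R U i) (Z k) = x k * B (U k) (Z k)"
proof -
  have "B (\<Sum>i\<in>I. x i *\<^sub>R U i) (Z k) = (\<Sum>i\<in>I. if i = k then x k * B (U k) (Z k) else 0)"
    unfolding bilinear_sum_left[OF assms(1)]
    by (intro sum.cong) (use assms in \<open>auto simp: facet_normals_zero\<close>)
  then show ?thesis using assms by simp
qed

lemma facet_normals_imp_coeff_zero:
  assumes "bilinear B" "finite I" "facet_normals B I U Z" "(\<Sum>i\<in>I. x i *\<^sub>R U i) = 0" "k \<in> I"
  shows "x k = 0"
proof -
  have "x k * B (U k) (Z k) = 0"
    using facet_normals_combination[OF assms(1,2,3,5), of x] assms(4)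
    by (simp add: bilinear_lzero[OF assms(1)])
  then show ?thesis using facet_normals_pos[OF assms(3,5)] by simp
qed

lemma facet_normals_inj_independent:
  assumes B: "bilinear B" and fin: "finite I" and N: "facet_normals B I U Z"
  shows "inj_on U I \<and> independent (U ` I)"
proof
  show inj: "inj_on U I"
  proof (rule inj_onI, rule ccontr)
    fix i k assume "i \<in> I" "k \<in> I" "U i = U k" "i \<noteq> k"
    then show False
      using facet_normals_pos[OF N, of i] facet_normals_zero[OF N, of k i] by simp
  qed
  show "independent (U ` I)"
  proof (rule independent_if_scalars_zero)
    fix f u assume s: "(\<Sum>u\<in>U ` I. f u *\<^sub>R u) = 0" and u: "u \<in> U ` I"
    then obtain k where k: "k \<in> I" "u = U k" by auto
    have "(\<Sum>i\<in>I. f (U i) *\<^sub>R U i) = 0"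
      using s by (simp add: sum.reindex[OF inj])
    from facet_normals_imp_coeff_zero[OF B fin N this k(1)] k show "f u = 0" by simp
  qed (use fin in simp)
qed

lemma spanning_if_independent_family:
  fixes Z :: "'i \<Rightarrow> 'a::euclidean_space"
  assumes "finite I" "card I = DIM('a)" "inj_on Z I" "independent (Z ` I)"
  shows "span (Z ` I) = UNIV"
proof -
  have "card (Z ` I) = DIM('a)" using assms by (simp add: card_image)
  then show ?thesis using card_ge_dim_independent[of "Z ` I" UNIV] assms by auto
qed

lemma facet_normals_span:
  fixes Z :: "'i \<Rightarrow> 'a::euclidean_space"
  assumes "bilinear B" "finite I" "card I = DIM('a)" "facet_normals B I U Z"
  shows "span (Z ` I) = UNIV"
proof -
  have "bilinear (\<lambda>x y. B y x)" using assms(1) by (simp add: bilinear_def)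
  moreover have "facet_normals (\<lambda>x y. B y x) I Z U"
    using assms(4) by (auto simp: facet_normals_def)
  ultimately show ?thesis
    using facet_normals_inj_independent[of "\<lambda>x y. B y x" I Z U] spanning_if_independent_family assms
    by blast
qed

lemma bilinear_zero_on_span:
  assumes "bilinear B" "\<And>z. z \<in> S \<Longrightarrow> B a z = (0::real)" "x \<in> span S"
  shows "B a x = 0"
proof -
  interpret linear "B a" using assms(1) by (simp add: bilinear_def)
  have "subspace {x. B a x = 0}" by (auto simp: subspace_def add scaleR zero)
  then have "span S \<subseteq> {x. B a x = 0}" by (intro span_minimal) (use assms in auto)
  then show ?thesis using assms(3) by auto
qed

lemma linear_functional_inner:
  fixes f :: "'a::euclidean_space \<Rightarrow> real"
  assumes "linear f"
  shows "\<exists>u. \<forall>x. f x = u \<bullet> x"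
  using adjoint_works[OF assms, of _ "1::real"] by (metis inner_commute inner_real_def mult.right_neutral)

lemma dual_basis_exists:
  fixes Z :: "'i \<Rightarrow> 'a::euclidean_space"
  assumes "finite I" "card I = DIM('a)" "\<And>a. (\<And>k. k \<in> I \<Longrightarrow> a \<bullet> Z k = 0) \<Longrightarrow> a = 0"
  shows "\<exists>U. \<forall>i\<in>I. \<forall>k\<in>I. U i \<bullet> Z k = (if i = k then 1 else 0)"
proof -
  have sp: "span (Z ` I) = UNIV"
  proof (rule ccontr)
    assume "span (Z ` I) \<noteq> UNIV"
    then obtain a where a: "a \<noteq> 0" "span (Z ` I) \<subseteq> {x. a \<bullet> x = 0}"
      using span_not_univ_subset_hyperplane by blast
    then have "a \<bullet> Z k = 0" if "k \<in> I" for k using that a(2) span_base[of "Z k" "Z ` I"] by auto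
    then show False using assms(3) a(1) by blast
  qed
  have le: "card (Z ` I) \<le> DIM('a)" using card_image_le[OF assms(1), of Z] assms(2) by simp
  have ind: "independent (Z ` I)"
    by (rule card_le_dim_spanning[of _ UNIV]) (use sp le assms in auto)
  have "card (Z ` I) = card I"
    using basis_card_eq_dim[of "Z ` I" UNIV] ind sp assms(2) by simp
  then have inj: "inj_on Z I" using assms(1) by (simp add: eq_card_imp_inj_on)
  have "\<exists>u. \<forall>k\<in>I. u \<bullet> Z k = (if i = k then 1 else 0)" if "i \<in> I" for i
  proof -
    obtain f :: "'a \<Rightarrow> real" where f: "linear f" "\<forall>x\<in>Z ` I. f x = (if x = Z i then 1 else 0)"
      using linear_independent_extend[OF ind, of "\<lambda>x. if x = Z i then 1 else (0::real)"] by blast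
    obtain u where "\<forall>x. f x = u \<bullet> x" using linear_functional_inner[OF f(1)] by blast
    then have "\<forall>k\<in>I. u \<bullet> Z k = (if i = k then 1 else 0)"
      using f(2) inj that by (auto simp: inj_on_eq_iff)
    then show ?thesis by blast
  qed
  then show ?thesis by metis
qed

text \<open>
  The ridge is the intersection of the two facets: in the basis \<open>Z\<close> the coefficients at \<open>i\<close> and \<open>j\<close> are
  read off by the two normals.
\<close>

lemma in_ridge_span:
  assumes B: "bilinear B" and sp: "span (Z ` I) = UNIV" and N: "facet_normals B I U Z"
    and ij: "i \<in> I" "j \<in> I" "i \<noteq> j" and w: "B (U i) w = 0" "B (U j) w = 0"
  shows "w \<in> span (Z ` (I - {i, j}))"
proof -
  have "Z ` I = insert (Z i) (insert (Z j) (Z ` (I - {i, j})))" using ij by auto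
  then have "w \<in> span (insert (Z i) (insert (Z j) (Z ` (I - {i, j}))))" using sp by simp
  then obtain a b where ab: "w - a *\<^sub>R Z i - b *\<^sub>R Z j \<in> span (Z ` (I - {i, j}))"
    by (auto simp: span_breakdown_eq)
  have "B (U l) (w - a *\<^sub>R Z i - b *\<^sub>R Z j) = 0" if "l \<in> {i, j}" for l
    by (rule bilinear_zero_on_span[OF B _ ab]) (use that facet_normals_ridge[OF N ij(1,2)] in blast)
  from this[of i] this[of j] have "a * B (U i) (Z i) = 0" "b * B (U j) (Z j) = 0"
    using w ij N by (simp_all add: bilinear_rsub[OF B] bilinear_rmul[OF B] facet_normals_zero)
  then have "a = 0" "b = 0" using facet_normals_pos[OF N] ij by (metis less_irrefl mult_eq_0_iff)+
  then show ?thesis using ab by simp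
qed


section \<open>Dihedral angles in terms of facet normals\<close>

text \<open>
  The determinant of a definite plane is positive, since \<open>B v v\<close> times it is the form at
  \<open>B v v *\<^sub>R u - B u v *\<^sub>R v\<close>.
\<close>

lemma gram_det_pos:
  assumes B: "bilinear B" and sym: "\<And>x y. B x y = B y x"
    and pos: "\<forall>a b. a \<noteq> 0 \<or> b \<noteq> 0 \<longrightarrow> B (a *\<^sub>R u + b *\<^sub>R v) (a *\<^sub>R u + b *\<^sub>R v) > (0::real)"
  shows "B u u > 0" "B v v > 0" "(B u v)\<^sup>2 < B u u * B v v"
proof -
  show u: "B u u > 0" using pos[rule_format, of 1 0] by simp
  show v: "B v v > 0" using pos[rule_format, of 0 1] by simp
  have "B (B v v *\<^sub>R u + (- B u v) *\<^sub>R v) (B v v *\<^sub>R u + (- B u v) *\<^sub>R v) > 0"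
    by (intro pos[rule_format]) (use v in simp)
  also have "B (B v v *\<^sub>R u + (- B u v) *\<^sub>R v) (B v v *\<^sub>R u + (- B u v) *\<^sub>R v)
      = B v v * (B u u * B v v - (B u v)\<^sup>2)"
    unfolding bilinear_ladd[OF B] bilinear_radd[OF B] bilinear_lmul[OF B] bilinear_rmul[OF B]
      sym[of v u]
    by (simp add: algebra_simps power2_eq_square)
  finally show "(B u v)\<^sup>2 < B u u * B v v" using v by (simp add: zero_less_mult_iff)
qed

lemma abs_cosine_less_1:
  assumes "B u u > 0" "B v v > 0" "(B u v)\<^sup>2 < B u u * B v v"
  shows "\<bar>cosine_wrt B u v\<bar> < 1"
proof -
  have "\<bar>B u v\<bar> < sqrt (B u u * B v v)" using assms(3) by (metis real_sqrt_abs real_sqrt_less_iff)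
  then show ?thesis using assms by (simp add: cosine_wrt_def abs_mult real_sqrt_mult)
qed

text \<open>
  In a definite plane, the two arguments on the left are the directions orthogonal to \<open>v\<close> on the side
  of \<open>u\<close>, and orthogonal to \<open>u\<close> on the side of \<open>v\<close>. A quarter turn each way makes the angle between
  them supplementary to that of \<open>u\<close> and \<open>v\<close>.
\<close>

lemma angle_in_plane:
  assumes B: "bilinear B" and sym: "\<And>x y. B x y = B y x"
    and u: "B u u > 0" and v: "B v v > 0" and d: "(B u v)\<^sup>2 < B u u * B v v"
    and "\<alpha> > 0" "\<beta> > (0::real)"
  shows "angle_wrt B (\<alpha> *\<^sub>R (B v v *\<^sub>R u - B u v *\<^sub>R v)) (\<beta> *\<^sub>R (B u u *\<^sub>R v - B v u *\<^sub>R u))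
    = arccos (- cosine_wrt B u v)"
proof -
  define D where "D = B u u * B v v - (B u v)\<^sup>2"
  have D: "D > 0" using d by (simp add: D_def)
  let ?p = "\<alpha> *\<^sub>R (B v v *\<^sub>R u - B u v *\<^sub>R v)" and ?q = "\<beta> *\<^sub>R (B u u *\<^sub>R v - B v u *\<^sub>R u)"
  note bil = bilinear_lsub[OF B] bilinear_rsub[OF B] bilinear_lmul[OF B] bilinear_rmul[OF B]
  have pp: "B ?p ?p = \<alpha>\<^sup>2 * D * B v v" and qq: "B ?q ?q = \<beta>\<^sup>2 * D * B u u"
    and pq: "B ?p ?q = - (\<alpha> * \<beta> * D) * B u v"
    unfolding bil sym[of v u] by (simp_all add: D_def algebra_simps power2_eq_square)
  have "sqrt (B ?p ?p) * sqrt (B ?q ?q) = \<alpha> * \<beta> * D * (sqrt (B u u) * sqrt (B v v))"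
    using assms(6,7) D unfolding pp qq by (simp add: real_sqrt_mult)
  then have "B ?p ?q / (sqrt (B ?p ?p) * sqrt (B ?q ?q)) = - cosine_wrt B u v"
    using assms(6,7) D unfolding pq cosine_wrt_def by simp
  then show ?thesis by (simp add: angle_wrt_def)
qed

text \<open>
  The orthogonal complement of the ridge is the plane of the two facet normals, and the component of
  \<open>Z i\<close> in it is orthogonal to \<open>U j\<close>, as \<open>Z i\<close> lies on the facet with that normal. This fixes its
  direction, and the product with \<open>U i\<close> fixes its length.
\<close>

lemma linear_normal_part_eq:
  assumes B: "bilinear B" and sym: "\<And>x y. B x y = B y x"
    and nondeg: "\<forall>x. (\<forall>y. B x y = 0) \<longrightarrow> x = 0"
    and sp: "span (Z ` I) = UNIV" and N: "facet_normals B I U Z"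
    and ij: "i \<in> I" "j \<in> I" "i \<noteq> j"
    and d: "(B (U i) (U j))\<^sup>2 < B (U i) (U i) * B (U j) (U j)"
  shows "linear_normal_part B (Z ` (I - {i, j})) (Z i) =
    (B (U i) (Z i) / (B (U i) (U i) * B (U j) (U j) - (B (U i) (U j))\<^sup>2)) *\<^sub>R
      (B (U j) (U j) *\<^sub>R U i - B (U i) (U j) *\<^sub>R U j)" (is "_ = ?v")
proof -
  let ?R = "Z ` (I - {i, j})"
  define D where "D = B (U i) (U i) * B (U j) (U j) - (B (U i) (U j))\<^sup>2"
  have D: "D > 0" using d by (simp add: D_def)
  note bil = bilinear_ladd[OF B] bilinear_radd[OF B] bilinear_lsub[OF B] bilinear_rsub[OF B]
    bilinear_lmul[OF B] bilinear_rmul[OF B]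
  have v: "?v = (B (U i) (Z i) / D) *\<^sub>R (B (U j) (U j) *\<^sub>R U i - B (U i) (U j) *\<^sub>R U j)"
    by (simp add: D_def)
  have vR: "B ?v r = 0" if "r \<in> ?R" for r
    using that ij N unfolding v bil by (auto simp: facet_normals_zero)
  have "B (U i) (Z i - ?v) = 0"
    using D unfolding v bil by (simp add: field_simps D_def power2_eq_square)
  moreover have "B (U j) (Z i - ?v) = 0"
    using ij N D unfolding v bil sym[of "U j" "U i"] by (simp add: facet_normals_zero)
  ultimately have vS: "Z i - ?v \<in> span ?R" by (rule in_ridge_span[OF B sp N ij])
  have unique: "x = ?v" if x: "Z i - x \<in> span ?R" "\<forall>r\<in>?R. B x r = 0" for x
  proof -
    define e where "e = ?v - x"
    have eS: "e \<in> span ?R" using span_diff[OF x(1) vS] by (simp add: e_def algebra_simps)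
    have er: "B e r = 0" if "r \<in> ?R" for r
    proof -
      have "B x r = 0" using x(2) that by blast
      then show ?thesis using vR[OF that] unfolding e_def bilinear_lsub[OF B] by simp
    qed
    have eU: "B (U l) e = 0" if "l \<in> {i, j}" for l
      by (rule bilinear_zero_on_span[OF B _ eS]) (use that facet_normals_ridge[OF N ij(1,2)] in blast)
    \<comment> \<open>Subtracting from \<open>e\<close> its components along the two normals leaves a vector in the radical.\<close>
    define a where "a = B e (Z i) / B (U i) (Z i)"
    define b where "b = B e (Z j) / B (U j) (Z j)"
    have "B (e - a *\<^sub>R U i - b *\<^sub>R U j) (Z k) = 0" if "k \<in> I" for k
    proof -
      have *: "B (e - a *\<^sub>R U i - b *\<^sub>R U j) (Z k)
          = B e (Z k) - a * B (U i) (Z k) - b * B (U j) (Z k)"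
        by (simp add: bil)
      have p: "B (U i) (Z i) \<noteq> 0" "B (U j) (Z j) \<noteq> 0"
        and z: "B (U i) (Z j) = 0" "B (U j) (Z i) = 0" using N ij unfolding facet_normals_def by force+
      consider "k = i" | "k = j" | "k \<noteq> i" "k \<noteq> j" by blast
      then show ?thesis
      proof cases
        case 3
        then have "B e (Z k) = 0" "B (U i) (Z k) = 0" "B (U j) (Z k) = 0"
          using er[of "Z k"] that ij N unfolding facet_normals_def by auto
        then show ?thesis by (simp add: *)
      qed (use * p z in \<open>auto simp: a_def b_def\<close>)
    qed
    then have "\<And>z. z \<in> Z ` I \<Longrightarrow> B (e - a *\<^sub>R U i - b *\<^sub>R U j) z = 0" by blast
    then have "B (e - a *\<^sub>R U i - b *\<^sub>R U j) y = 0" for y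
      using bilinear_zero_on_span[OF B, of "Z ` I" _ y] sp by blast
    then have "e - a *\<^sub>R U i - b *\<^sub>R U j = 0" using nondeg by blast
    then have e: "e = a *\<^sub>R U i + b *\<^sub>R U j" by (simp add: algebra_simps)
    have 1: "a * B (U i) (U i) + b * B (U i) (U j) = 0" using eU[of i] unfolding e bil by simp
    have 2: "a * B (U i) (U j) + b * B (U j) (U j) = 0"
      using eU[of j] unfolding e bil sym[of "U j" "U i"] by simp
    have "a * D = 0" "b * D = 0" unfolding D_def power2_eq_square using 1 2 by algebra+
    then have "a = 0" "b = 0" using D by auto
    then show ?thesis using e by (simp add: e_def)
  qed
  show ?thesis
    unfolding linear_normal_part_def
  proof (rule the_equality)
    show "Z i - ?v \<in> span ?R \<and> (\<forall>r\<in>?R. B ?v r = 0)" using vS vR by blast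
  qed (use unique in blast)
qed

lemma linear_dihedral:
  assumes B: "bilinear B" and sym: "\<And>x y. B x y = B y x"
    and nondeg: "\<forall>x. (\<forall>y. B x y = 0) \<longrightarrow> x = 0"
    and sp: "span (Z ` I) = UNIV" and N: "facet_normals B I U Z"
    and ij: "i \<in> I" "j \<in> I" "i \<noteq> j"
    and u: "B (U i) (U i) > 0" and v: "B (U j) (U j) > 0"
    and d: "(B (U i) (U j))\<^sup>2 < B (U i) (U i) * B (U j) (U j)"
  shows "angle_wrt B (linear_normal_part B (Z ` (I - {i, j})) (Z i))
      (linear_normal_part B (Z ` (I - {i, j})) (Z j)) = arccos (- cosine_wrt B (U i) (U j))"
proof -
  have d': "(B (U j) (U i))\<^sup>2 < B (U j) (U j) * B (U i) (U i)"
    using d sym[of "U j" "U i"] by (simp add: mult.commute)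
  have s: "{j, i} = {i, j}" by auto
  note vi = linear_normal_part_eq[OF B sym nondeg sp N ij d]
  note vj = linear_normal_part_eq[OF B sym nondeg sp N ij(2,1) ij(3)[symmetric] d', unfolded s]
  show ?thesis
    unfolding vi vj
    by (rule angle_in_plane[OF B sym u v d]) (use d d' facet_normals_pos[OF N] ij in auto)
qed

section \<open>Euclidean simplexes\<close>

lemma in_affine_hull_if_lift_in_span:
  assumes "(x, 1) \<in> span ((\<lambda>z. (z, 1::real)) ` R)"
  shows "x \<in> affine hull R"
proof -
  obtain t r where t: "finite t" "t \<subseteq> (\<lambda>z. (z, 1::real)) ` R"
    and x: "(x, 1) = (\<Sum>a\<in>t. r a *\<^sub>R a)"
    using assms unfolding span_explicit by blast
  obtain s where s: "s \<subseteq> R" "finite s" "t = (\<lambda>z. (z, 1)) ` s"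
    using finite_subset_image[OF t] by blast
  have inj: "inj_on (\<lambda>z. (z, 1::real)) s" by (auto intro: inj_onI)
  have e: "(x, 1) = (\<Sum>v\<in>s. r (v, 1) *\<^sub>R (v, 1::real))"
    unfolding x s(3) by (simp add: sum.reindex[OF inj])
  have fs: "(\<Sum>v\<in>s. r (v, 1) *\<^sub>R v) = x" using arg_cong[OF e, of fst] by (simp add: fst_sum)
  have sn: "(\<Sum>v\<in>s. r (v, 1)) = 1" using arg_cong[OF e, of snd] by (simp add: snd_sum)
  then have "s \<noteq> {}" by auto
  then show ?thesis unfolding affine_hull_explicit
    using s(1,2) sn fs by (intro CollectI exI[of _ s] exI[of _ "\<lambda>v. r (v, 1)"]) simp
qed

lemma lift_normals_fst:
  assumes "facet_normals inner I U (\<lambda>k. (z k, 1::real))" "l \<in> I" "r \<in> z ` (I - {l})" "s \<in> z ` (I - {l})"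
  shows "fst (U l) \<bullet> (r - s) = 0"
proof -
  have "U l \<bullet> (r, 1) = 0" "U l \<bullet> (s, 1) = 0" using assms unfolding facet_normals_def by auto
  then show ?thesis by (simp add: inner_prod_def inner_diff_right)
qed

text \<open>
  Same formula as in the linear models. Membership in the affine hull of the ridge is tested on the
  lifted points \<open>(z k, 1)\<close>, whereas orthogonality only concerns the parts \<open>u\<close>, \<open>v\<close> of the normals in
  \<open>real^'n\<close>.
\<close>

lemma affine_normal_part_eq:
  assumes sp: "span ((\<lambda>k. (z k, 1::real)) ` I) = UNIV"
    and N: "facet_normals inner I U (\<lambda>k. (z k, 1::real))"
    and ij: "i \<in> I" "j \<in> I" "i \<noteq> j"
    and uu: "u = fst (U i)" "v = fst (U j)"
    and d: "(u \<bullet> v)\<^sup>2 < (u \<bullet> u) * (v \<bullet> v)"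
  shows "affine_normal_part (z ` (I - {i, j})) (z i) =
    ((U i \<bullet> (z i, 1)) / ((u \<bullet> u) * (v \<bullet> v) - (u \<bullet> v)\<^sup>2)) *\<^sub>R
      ((v \<bullet> v) *\<^sub>R u - (u \<bullet> v) *\<^sub>R v)"
proof -
  let ?R = "z ` (I - {i, j})"
  define D where "D = (u \<bullet> u) * (v \<bullet> v) - (u \<bullet> v)\<^sup>2"
  have D: "D > 0" using d by (simp add: D_def)
  define w where "w = ((U i \<bullet> (z i, 1)) / D) *\<^sub>R ((v \<bullet> v) *\<^sub>R u - (u \<bullet> v) *\<^sub>R v)"
  have wR: "w \<bullet> (r - s) = 0" if "r \<in> ?R" "s \<in> ?R" for r s
  proof -
    have "u \<bullet> (r - s) = 0" "v \<bullet> (r - s) = 0"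
      unfolding uu using lift_normals_fst[OF N, of i r s] lift_normals_fst[OF N, of j r s] that ij by auto
    then show ?thesis by (simp add: w_def inner_diff_left)
  qed
  have "u \<bullet> w = (U i \<bullet> (z i, 1)) / D * ((v \<bullet> v) * (u \<bullet> u) - (u \<bullet> v) * (u \<bullet> v))"
    by (simp add: w_def inner_diff_right)
  also have "(v \<bullet> v) * (u \<bullet> u) - (u \<bullet> v) * (u \<bullet> v) = D" by (simp add: D_def power2_eq_square mult.commute)
  finally have "u \<bullet> w = U i \<bullet> (z i, 1)" using D by simp
  then have 1: "U i \<bullet> (z i - w, 1) = 0" by (simp add: uu inner_prod_def inner_diff_right)
  have "v \<bullet> w = 0" by (simp add: w_def inner_diff_right inner_commute[of v u])
  moreover have "U j \<bullet> (z i, 1) = 0" using N ij unfolding facet_normals_def by auto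
  ultimately have 2: "U j \<bullet> (z i - w, 1) = 0" by (simp add: uu inner_prod_def inner_diff_right)
  have "(z i - w, 1) \<in> span ((\<lambda>k. (z k, 1::real)) ` (I - {i, j}))"
    by (rule in_ridge_span[OF bilinear_inner sp N ij 1 2])
  then have wS: "z i - w \<in> affine hull ?R"
    by (intro in_affine_hull_if_lift_in_span) (simp add: image_image)
  have unique: "x = w" if x: "z i - x \<in> affine hull ?R" "\<forall>r\<in>?R. \<forall>s\<in>?R. x \<bullet> (r - s) = 0" for x
  proof -
    define e where "e = w - x"
    have eR: "e \<bullet> (r - s) = 0" if "r \<in> ?R" "s \<in> ?R" for r s
    proof -
      have "x \<bullet> (r - s) = 0" using x(2) that by blast
      then show ?thesis using wR[OF that] unfolding e_def inner_diff_left by simp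
    qed
    obtain s where s: "s \<in> ?R" using x(1) by (metis affine_hull_empty empty_iff ex_in_conv)
    have "e \<bullet> r = e \<bullet> s" if "r \<in> ?R" for r
      using eR[OF that s] by (simp only: inner_diff_right right_minus_eq)
    then have "?R \<subseteq> {p. e \<bullet> p = e \<bullet> s}" by blast
    then have sub: "affine hull ?R \<subseteq> {p. e \<bullet> p = e \<bullet> s}"
      by (rule hull_minimal) (rule affine_hyperplane)
    note CollectD[OF subsetD[OF sub x(1)]] CollectD[OF subsetD[OF sub wS]]
    then have "e \<bullet> ((z i - x) - (z i - w)) = 0" by (simp only: inner_diff_right[of e "z i - x"] diff_self)
    moreover have "(z i - x) - (z i - w) = e" by (simp add: e_def)
    ultimately have "e \<bullet> e = 0" by (simp only:)
    then show ?thesis by (simp add: e_def)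
  qed
  have "affine_normal_part ?R (z i) = w"
    unfolding affine_normal_part_def
  proof (rule the_equality)
    show "z i - w \<in> affine hull ?R \<and> (\<forall>r\<in>?R. \<forall>s\<in>?R. w \<bullet> (r - s) = 0)" using wS wR by blast
  qed (use unique in blast)
  then show ?thesis by (simp add: w_def D_def)
qed

text \<open>
  In dimension at least two every ridge has a vertex.
\<close>

lemma third_index:
  assumes "CARD('n::finite) \<ge> 2"
  obtains k where "k \<in> {1..CARD('n) + 1}" "k \<noteq> i" "k \<noteq> (j::nat)"
proof -
  have "card {1..CARD('n) + 1} > card {i, j}" using assms by (simp add: card_insert_if)
  then have "\<not> {1..CARD('n) + 1} \<subseteq> {i, j}" using card_mono[of "{i, j}"] by (metis finite.emptyI finite.insertI leD)
  then show ?thesis using that by blast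
qed

text \<open>
  The normals of two distinct facets are linearly independent: along the edge from a ridge vertex to
  \<open>z i\<close> only the function of facet \<open>i\<close> varies, and likewise for \<open>j\<close>.
\<close>

lemma euclidean_normals_definite:
  fixes z :: "nat \<Rightarrow> real^'n"
  assumes n: "CARD('n) \<ge> 2" and N: "facet_normals inner {1..CARD('n) + 1} U (\<lambda>k. (z k, 1::real))"
    and ij: "i \<in> {1..CARD('n) + 1}" "j \<in> {1..CARD('n) + 1}" "i \<noteq> j"
  shows "\<forall>a b. a \<noteq> 0 \<or> b \<noteq> 0 \<longrightarrow>
    (a *\<^sub>R fst (U i) + b *\<^sub>R fst (U j)) \<bullet> (a *\<^sub>R fst (U i) + b *\<^sub>R fst (U j)) > 0"
proof (intro allI impI)
  fix a b :: real assume ab: "a \<noteq> 0 \<or> b \<noteq> 0"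
  let ?p = "a *\<^sub>R fst (U i) + b *\<^sub>R fst (U j)"
  define I where "I = {1..CARD('n) + 1}"
  note N = N[folded I_def] and ij = ij[folded I_def]
  obtain k where k: "k \<in> I" "k \<noteq> i" "k \<noteq> j"
    using third_index[OF n] unfolding I_def by metis
  have *: "fst (U l) \<bullet> (z m - z k) = U l \<bullet> (z m, 1) - U l \<bullet> (z k, 1)" for l m
    by (simp add: inner_prod_def inner_diff_right)
  have "U l \<bullet> (z k, 1) = 0" if "l \<in> {i, j}" for l using N ij k that unfolding facet_normals_def by auto
  then have i: "?p \<bullet> (z i - z k) = a * (U i \<bullet> (z i, 1))" and j: "?p \<bullet> (z j - z k) = b * (U j \<bullet> (z j, 1))"
    using N ij k unfolding facet_normals_def by (simp_all add: inner_add_left *)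
  have "U i \<bullet> (z i, 1) > 0" "U j \<bullet> (z j, 1) > 0" using N ij unfolding facet_normals_def by auto
  then have "?p \<noteq> 0" using i j ab by auto
  then show "?p \<bullet> ?p > 0" by simp
qed

lemma lift_span:
  fixes z :: "nat \<Rightarrow> real^'n"
  assumes "facet_normals inner {1..CARD('n) + 1} U (\<lambda>k. (z k, 1::real))"
  shows "span ((\<lambda>k. (z k, 1::real)) ` {1..CARD('n) + 1}) = UNIV"
  by (rule facet_normals_span[OF bilinear_inner _ _ assms]) auto

lemma euclidean_dihedral_eq:
  fixes z :: "nat \<Rightarrow> real^'n"
  assumes n: "CARD('n) \<ge> 2" and N: "facet_normals inner {1..CARD('n) + 1} U (\<lambda>k. (z k, 1::real))"
    and ij: "i \<in> {1..CARD('n) + 1}" "j \<in> {1..CARD('n) + 1}" "i \<noteq> j"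
  shows "euclidean_dihedral z i j = arccos (- cosine_wrt inner (fst (U i)) (fst (U j)))"
    and "\<bar>cosine_wrt inner (fst (U i)) (fst (U j))\<bar> < 1"
proof -
  define I where "I = {1..CARD('n) + 1}"
  define u v where "u = fst (U i)" and "v = fst (U j)"
  note sp = lift_span[OF N, folded I_def]
  note g = gram_det_pos[OF bilinear_inner inner_commute euclidean_normals_definite[OF n N ij], folded u_def v_def]
  have u: "u \<bullet> u > 0" and v: "v \<bullet> v > 0" and d: "(u \<bullet> v)\<^sup>2 < (u \<bullet> u) * (v \<bullet> v)"
    using g .
  have d': "(v \<bullet> u)\<^sup>2 < (v \<bullet> v) * (u \<bullet> u)" using d by (simp add: inner_commute mult.commute)
  note N = N[folded I_def] and ij = ij[folded I_def]
  have s: "{j, i} = {i, j}" by auto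
  note vi = affine_normal_part_eq[OF sp N ij u_def v_def d]
  note vj = affine_normal_part_eq[OF sp N ij(2,1) ij(3)[symmetric] v_def u_def d', unfolded s]
  have pi: "U i \<bullet> (z i, 1) > 0" "U j \<bullet> (z j, 1) > 0" using N ij unfolding facet_normals_def by auto
  have "angle_wrt inner (affine_normal_part (z ` (I - {i, j})) (z i))
     (affine_normal_part (z ` (I - {i, j})) (z j)) = arccos (- cosine_wrt inner u v)"
    unfolding vi vj
    by (rule angle_in_plane[OF bilinear_inner inner_commute u v d])
      (use d d' pi in \<open>simp_all only: divide_pos_pos diff_gt_0_iff_gt\<close>)
  then show "euclidean_dihedral z i j = arccos (- cosine_wrt inner (fst (U i)) (fst (U j)))"
    by (simp add: euclidean_dihedral_def ridge_vertices_def I_def u_def v_def Let_def)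
  show "\<bar>cosine_wrt inner (fst (U i)) (fst (U j))\<bar> < 1"
    using abs_cosine_less_1[OF u v d] by (simp add: u_def v_def)
qed

lemma euclidean_simplex_iff:
  fixes z :: "nat \<Rightarrow> real^'n"
  shows "euclidean_simplex z \<longleftrightarrow> (\<exists>U. facet_normals inner {1..CARD('n) + 1} U (\<lambda>k. (z k, 1::real)))"
proof
  assume E: "euclidean_simplex z"
  have "a = 0" if a: "\<And>k. k \<in> {1..CARD('n) + 1} \<Longrightarrow> a \<bullet> (z k, 1::real) = 0" for a
  proof (rule ccontr)
    assume "a \<noteq> 0"
    have eq: "fst a \<bullet> z k = - snd a" if "k \<in> {1..CARD('n) + 1}" for k
      using a[OF that] by (simp add: inner_prod_def)
    show False
    proof (cases "fst a = 0")
      case True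
      then show False using eq[of 1] \<open>a \<noteq> 0\<close> by (simp add: prod_eq_iff)
    next
      case False
      then have "euclidean_hyperplane {x. fst a \<bullet> x = - snd a}" unfolding euclidean_hyperplane_def by blast
      moreover have "z ` {1..CARD('n) + 1} \<subseteq> {x. fst a \<bullet> x = - snd a}" using eq by blast
      ultimately show False using E unfolding euclidean_simplex_def by blast
    qed
  qed
  then have "\<exists>U. \<forall>i\<in>{1..CARD('n) + 1}. \<forall>k\<in>{1..CARD('n) + 1}.
      U i \<bullet> (z k, 1::real) = (if i = k then 1 else 0)"
    by (intro dual_basis_exists) simp_all
  then show "\<exists>U. facet_normals inner {1..CARD('n) + 1} U (\<lambda>k. (z k, 1::real))"
    unfolding facet_normals_def by (metis zero_less_one)
next
  assume "\<exists>U. facet_normals inner {1..CARD('n) + 1} U (\<lambda>k. (z k, 1::real))"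
  then have sp: "span ((\<lambda>k. (z k, 1::real)) ` {1..CARD('n) + 1}) = UNIV" using lift_span by blast
  show "euclidean_simplex z"
    unfolding euclidean_simplex_def euclidean_hyperplane_def
  proof clarify
    fix a b assume a: "a \<noteq> 0" and s: "z ` {1..CARD('n) + 1} \<subseteq> {x. a \<bullet> x = b}"
    have "(a, - b) \<bullet> y = 0" if "y \<in> (\<lambda>k. (z k, 1::real)) ` {1..CARD('n) + 1}" for y
      using that s by (auto simp: inner_prod_def)
    then have "(a, - b) \<bullet> x = 0" for x
      using bilinear_zero_on_span[OF bilinear_inner, of "(\<lambda>k. (z k, 1::real)) ` {1..CARD('n) + 1}"] sp
      by blast
    from this[of "(a, 0)"] show False using a by (simp add: inner_prod_def)
  qed
qed

section \<open>Spherical and hyperbolic simplexes\<close>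

lemma lorentz_sym: "lorentz x y = lorentz y x"
  by (simp add: lorentz_def inner_commute mult.commute)

lemma bilinear_lorentz: "bilinear lorentz"
  by (auto simp: bilinear_def linear_iff lorentz_def inner_add_left inner_add_right algebra_simps)

lemma lorentz_eq_inner: "lorentz x y = (fst x, - snd x) \<bullet> y"
  by (simp add: lorentz_def inner_prod_def)

lemma lorentz_nondegenerate: "(\<forall>y. lorentz x y = 0) \<Longrightarrow> x = 0"
  using inner_eq_zero_iff[of "(fst x, - snd x)"] unfolding lorentz_eq_inner by (metis fst_conv neg_equal_0_iff_equal prod_eq_iff snd_conv zero_prod_def)

text \<open>
  Cauchy-Schwarz in the space part bounds \<open>\<bar>snd a\<bar> \<bar>snd p\<bar>\<close> by \<open>norm (fst a) norm (fst p)\<close>, and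
  \<open>norm (fst p) < \<bar>snd p\<bar>\<close>. This supplies the positivity that makes hyperbolic facet normals behave
  like Euclidean ones.
\<close>

lemma spacelike_if_orthogonal_to_timelike:
  assumes p: "lorentz p p < 0" and a: "lorentz a p = 0" "a \<noteq> 0"
  shows "lorentz a a > 0"
proof -
  obtain p1 p2 where pp: "p = (p1, p2)" by (cases p)
  obtain a1 a2 where aa: "a = (a1, a2)" by (cases a)
  have p2: "(norm p1)\<^sup>2 < p2\<^sup>2" using p by (simp add: pp lorentz_def power2_norm_eq_inner power2_eq_square[of p2])
  have "a1 \<bullet> p1 = a2 * p2" using a by (simp add: pp aa lorentz_def)
  then have le: "\<bar>a2\<bar> * \<bar>p2\<bar> \<le> norm a1 * norm p1" by (metis Cauchy_Schwarz_ineq2 abs_mult)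
  have lt: "norm p1 < \<bar>p2\<bar>" using p2 by (metis abs_le_square_iff abs_norm_cancel not_le)
  have "\<bar>a2\<bar> < norm a1"
  proof (cases "a1 = 0")
    case True
    then have "\<bar>a2\<bar> * \<bar>p2\<bar> \<le> 0" using le by simp
    moreover have "\<bar>p2\<bar> > 0" using lt norm_ge_zero[of p1] by linarith
    ultimately have "a2 = 0" by (smt (verit) mult_pos_pos)
    then show ?thesis using True a(2) aa by (simp add: prod_eq_iff)
  next
    case False
    then have "\<bar>a2\<bar> * \<bar>p2\<bar> < norm a1 * \<bar>p2\<bar>" using le lt by (smt (verit) mult_strict_left_mono norm_eq_zero norm_ge_zero)
    then show ?thesis by (simp add: mult_less_cancel_right)
  qed
  then have "\<bar>a2\<bar>\<^sup>2 < (norm a1)\<^sup>2" by (intro power_strict_mono) auto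
  then show ?thesis by (simp add: aa lorentz_def power2_norm_eq_inner power2_eq_square[of a2])
qed

lemma lorentz_neg_if_hyperbolic:
  assumes "p \<in> hyperbolic_space" "q \<in> hyperbolic_space"
  shows "lorentz p q < 0"
proof -
  have *: "norm (fst x) < snd x" if "x \<in> hyperbolic_space" for x :: "(real^'n) \<times> real"
  proof -
    have "(norm (fst x))\<^sup>2 < (snd x)\<^sup>2" "snd x > 0" using that
      by (simp_all add: hyperbolic_space_def lorentz_def power2_norm_eq_inner power2_eq_square[of "snd x"])
    then show ?thesis using power2_less_imp_less by fastforce
  qed
  have "fst p \<bullet> fst q \<le> norm (fst p) * norm (fst q)" by (rule norm_cauchy_schwarz)
  also have "\<dots> < snd p * snd q" using *[OF assms(1)] *[OF assms(2)] by (intro mult_strict_mono') auto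
  finally show ?thesis by (simp add: lorentz_def)
qed

lemma spherical_simplex_iff:
  fixes z :: "nat \<Rightarrow> (real^'n) \<times> real"
  shows "spherical_simplex z \<longleftrightarrow> z ` {1..CARD('n) + 1} \<subseteq> unit_sphere \<and>
    (\<exists>U. facet_normals inner {1..CARD('n) + 1} U z)"
proof
  assume S: "spherical_simplex z"
  then have sp: "span (z ` {1..CARD('n) + 1}) = UNIV"
    unfolding spherical_simplex_def by (intro spanning_if_independent_family) auto
  have "a = 0" if a: "\<And>k. k \<in> {1..CARD('n) + 1} \<Longrightarrow> a \<bullet> z k = 0" for a
  proof -
    have "a \<bullet> a = 0"
      using bilinear_zero_on_span[OF bilinear_inner, of "z ` {1..CARD('n) + 1}" a a] a sp by blast
    then show ?thesis by simp
  qed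
  then have "\<exists>U. \<forall>i\<in>{1..CARD('n) + 1}. \<forall>k\<in>{1..CARD('n) + 1}. U i \<bullet> z k = (if i = k then 1 else 0)"
    by (intro dual_basis_exists) simp_all
  then obtain U where U: "\<forall>i\<in>{1..CARD('n) + 1}. \<forall>k\<in>{1..CARD('n) + 1}. U i \<bullet> z k = (if i = k then 1 else 0)"
    by blast
  have "facet_normals inner {1..CARD('n) + 1} U z"
    using U unfolding facet_normals_def by simp
  then show "z ` {1..CARD('n) + 1} \<subseteq> unit_sphere \<and> (\<exists>U. facet_normals inner {1..CARD('n) + 1} U z)"
    using S unfolding spherical_simplex_def by blast
next
  assume *: "z ` {1..CARD('n) + 1} \<subseteq> unit_sphere \<and> (\<exists>U. facet_normals inner {1..CARD('n) + 1} U z)"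
  then obtain U where "facet_normals inner {1..CARD('n) + 1} U z" by blast
  then have "facet_normals inner {1..CARD('n) + 1} z U" using facet_normals_sym inner_commute by metis
  from facet_normals_inj_independent[OF bilinear_inner _ this] * show "spherical_simplex z"
    unfolding spherical_simplex_def by simp
qed

text \<open>
  Vertices contained in some linear hyperplane lie on a hyperbolic hyperplane, since a nonzero vector
  orthogonal to a point of the hyperboloid is spacelike.
\<close>

lemma hyperbolic_simplex_iff:
  fixes z :: "nat \<Rightarrow> (real^'n) \<times> real"
  shows "hyperbolic_simplex z \<longleftrightarrow> z ` {1..CARD('n) + 1} \<subseteq> hyperbolic_space \<and>
    (\<exists>U. facet_normals lorentz {1..CARD('n) + 1} U z)"
proof
  assume H: "hyperbolic_simplex z"
  then have zH: "z k \<in> hyperbolic_space" if "k \<in> {1..CARD('n) + 1}" for k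
    using that unfolding hyperbolic_simplex_def by blast
  have "a = 0" if a: "\<And>k. k \<in> {1..CARD('n) + 1} \<Longrightarrow> a \<bullet> z k = 0" for a
  proof (rule ccontr)
    assume "a \<noteq> 0"
    define b where "b = (fst a, - snd a)"
    have b0: "b \<noteq> 0" using \<open>a \<noteq> 0\<close> by (auto simp: b_def prod_eq_iff)
    have b: "lorentz b (z k) = 0" if "k \<in> {1..CARD('n) + 1}" for k
      using a[OF that] by (simp add: lorentz_eq_inner b_def)
    have "lorentz (z 1) (z 1) < 0" using zH[of 1] by (simp add: hyperbolic_space_def)
    moreover have "lorentz b (z 1) = 0" using b[of 1] by simp
    ultimately have "lorentz b b > 0" using b0 by (rule spacelike_if_orthogonal_to_timelike)
    moreover have "z ` {1..CARD('n) + 1} \<subseteq> {x \<in> hyperbolic_space. lorentz b x = 0}" using b zH by blast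
    ultimately show False using H unfolding hyperbolic_simplex_def hyperbolic_hyperplane_def by blast
  qed
  then have "\<exists>U. \<forall>i\<in>{1..CARD('n) + 1}. \<forall>k\<in>{1..CARD('n) + 1}. U i \<bullet> z k = (if i = k then 1 else 0)"
    by (intro dual_basis_exists) simp_all
  then obtain U where U: "\<forall>i\<in>{1..CARD('n) + 1}. \<forall>k\<in>{1..CARD('n) + 1}. U i \<bullet> z k = (if i = k then 1 else 0)"
    by blast
  have "facet_normals lorentz {1..CARD('n) + 1} (\<lambda>i. (fst (U i), - snd (U i))) z"
    using U unfolding facet_normals_def lorentz_eq_inner by simp
  then show "z ` {1..CARD('n) + 1} \<subseteq> hyperbolic_space \<and> (\<exists>U. facet_normals lorentz {1..CARD('n) + 1} U z)"
    using H unfolding hyperbolic_simplex_def by blast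
next
  assume *: "z ` {1..CARD('n) + 1} \<subseteq> hyperbolic_space \<and> (\<exists>U. facet_normals lorentz {1..CARD('n) + 1} U z)"
  then obtain U where U: "facet_normals lorentz {1..CARD('n) + 1} U z" by blast
  have sp: "span (z ` {1..CARD('n) + 1}) = UNIV"
    by (rule facet_normals_span[OF bilinear_lorentz _ _ U]) auto
  show "hyperbolic_simplex z"
    unfolding hyperbolic_simplex_def hyperbolic_hyperplane_def
  proof (intro conjI notI; (elim exE conjE)?)
    show "z ` {1..CARD('n) + 1} \<subseteq> hyperbolic_space" using * by blast
  next
    fix P a assume a: "lorentz a a > 0" and P: "P = {x \<in> hyperbolic_space. lorentz a x = 0}"
      and s: "z ` {1..CARD('n) + 1} \<subseteq> P"
    have "lorentz a a = 0"
      using bilinear_zero_on_span[OF bilinear_lorentz, of "z ` {1..CARD('n) + 1}" a a] s P sp by blast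
    then show False using a by simp
  qed
qed

lemma spherical_dihedral_eq:
  fixes z :: "nat \<Rightarrow> (real^'n) \<times> real"
  assumes N: "facet_normals inner {1..CARD('n) + 1} U z"
    and ij: "i \<in> {1..CARD('n) + 1}" "j \<in> {1..CARD('n) + 1}" "i \<noteq> j"
  shows "spherical_dihedral z i j = arccos (- cosine_wrt inner (U i) (U j))"
    and "\<bar>cosine_wrt inner (U i) (U j)\<bar> < 1"
proof -
  define I where "I = {1..CARD('n) + 1}"
  have sp: "span (z ` I) = UNIV"
    unfolding I_def by (rule facet_normals_span[OF bilinear_inner _ _ N]) auto
  note N = N[folded I_def] and ij = ij[folded I_def]
  have "(a *\<^sub>R U i + b *\<^sub>R U j) \<bullet> (a *\<^sub>R U i + b *\<^sub>R U j) > 0" if ab: "a \<noteq> 0 \<or> b \<noteq> 0" for a b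
  proof -
    have "(a *\<^sub>R U i + b *\<^sub>R U j) \<bullet> z i = a * (U i \<bullet> z i)" "(a *\<^sub>R U i + b *\<^sub>R U j) \<bullet> z j = b * (U j \<bullet> z j)"
      "U i \<bullet> z i > 0" "U j \<bullet> z j > 0"
      using N ij unfolding facet_normals_def by (simp_all add: inner_add_left)
    then have "a *\<^sub>R U i + b *\<^sub>R U j \<noteq> 0" using ab by auto
    then show ?thesis by simp
  qed
  then have "\<forall>a b. a \<noteq> 0 \<or> b \<noteq> 0 \<longrightarrow> (a *\<^sub>R U i + b *\<^sub>R U j) \<bullet> (a *\<^sub>R U i + b *\<^sub>R U j) > 0" by blast
  note g = gram_det_pos[OF bilinear_inner inner_commute this]
  have nd: "\<forall>x::(real^'n) \<times> real. (\<forall>y. x \<bullet> y = 0) \<longrightarrow> x = 0" by (metis inner_eq_zero_iff)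
  show "spherical_dihedral z i j = arccos (- cosine_wrt inner (U i) (U j))"
    using linear_dihedral[OF bilinear_inner inner_commute nd sp N ij g]
    by (simp add: spherical_dihedral_def ridge_vertices_def I_def Let_def)
  show "\<bar>cosine_wrt inner (U i) (U j)\<bar> < 1"
    using abs_cosine_less_1[of inner "U i" "U j"] g by blast
qed

text \<open>
  The plane of two facet normals is positive definite because it is orthogonal to a vertex of the
  ridge, which is timelike.
\<close>

lemma hyperbolic_dihedral_eq:
  fixes z :: "nat \<Rightarrow> (real^'n) \<times> real"
  assumes n: "CARD('n) \<ge> 2" and z: "z ` {1..CARD('n) + 1} \<subseteq> hyperbolic_space"
    and N: "facet_normals lorentz {1..CARD('n) + 1} U z"
    and ij: "i \<in> {1..CARD('n) + 1}" "j \<in> {1..CARD('n) + 1}" "i \<noteq> j"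
  shows "hyperbolic_dihedral z i j = arccos (- cosine_wrt lorentz (U i) (U j))"
    and "\<bar>cosine_wrt lorentz (U i) (U j)\<bar> < 1"
proof -
  define I where "I = {1..CARD('n) + 1}"
  have sp: "span (z ` I) = UNIV"
    unfolding I_def by (rule facet_normals_span[OF bilinear_lorentz _ _ N]) auto
  obtain k where k: "k \<in> I" "k \<noteq> i" "k \<noteq> j"
    using third_index[OF n] unfolding I_def by metis
  note N = N[folded I_def] and ij = ij[folded I_def] and z = z[folded I_def]
  note bil = bilinear_ladd[OF bilinear_lorentz] bilinear_lmul[OF bilinear_lorentz]
  have zk: "lorentz (z k) (z k) < 0" using z k(1) by (auto simp: hyperbolic_space_def)
  have "lorentz (a *\<^sub>R U i + b *\<^sub>R U j) (a *\<^sub>R U i + b *\<^sub>R U j) > 0" if ab: "a \<noteq> 0 \<or> b \<noteq> 0" for a b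
  proof -
    let ?p = "a *\<^sub>R U i + b *\<^sub>R U j"
    have "lorentz ?p (z i) = a * lorentz (U i) (z i)" "lorentz ?p (z j) = b * lorentz (U j) (z j)"
      "lorentz (U i) (z i) > 0" "lorentz (U j) (z j) > 0" and k: "lorentz ?p (z k) = 0"
      using N ij k unfolding facet_normals_def by (simp_all add: bil)
    then have "?p \<noteq> 0" using ab by (auto simp: bilinear_lzero[OF bilinear_lorentz])
    then show ?thesis using spacelike_if_orthogonal_to_timelike[OF zk k] by blast
  qed
  then have "\<forall>a b. a \<noteq> 0 \<or> b \<noteq> 0 \<longrightarrow>
      lorentz (a *\<^sub>R U i + b *\<^sub>R U j) (a *\<^sub>R U i + b *\<^sub>R U j) > 0" by blast
  note g = gram_det_pos[OF bilinear_lorentz lorentz_sym this]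
  have nd: "\<forall>x::(real^'n) \<times> real. (\<forall>y. lorentz x y = 0) \<longrightarrow> x = 0" using lorentz_nondegenerate by blast
  show "hyperbolic_dihedral z i j = arccos (- cosine_wrt lorentz (U i) (U j))"
    using linear_dihedral[OF bilinear_lorentz lorentz_sym nd sp N ij g]
    by (simp add: hyperbolic_dihedral_def ridge_vertices_def I_def Let_def)
  show "\<bar>cosine_wrt lorentz (U i) (U j)\<bar> < 1"
    using abs_cosine_less_1[of lorentz "U i" "U j"] g by blast
qed

section \<open>Realizing Euclidean simplexes with prescribed angles\<close>

text \<open>
  Gram-Schmidt in coordinates: splitting off the component along \<open>q a\<close> contributes the coordinate
  with index \<open>a\<close> and leaves vectors in the same span.
\<close>

lemma gram_factorization:
  fixes q :: "'i \<Rightarrow> 'a::real_vector"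
  assumes "finite I" "bilinear B" "\<And>x y. B x y = B y x"
    and "\<And>p. p \<in> span (q ` I) \<Longrightarrow> p \<noteq> 0 \<Longrightarrow> B p p > (0::real)"
  shows "\<exists>w. \<forall>i\<in>I. \<forall>j\<in>I. B (q i) (q j) = (\<Sum>k\<in>I. w i k * w j (k::'i))"
  using assms(1,4)
proof (induction I arbitrary: q rule: finite_induct)
  case (insert a I)
  note B = assms(2) and sym = assms(3)
  note bil = bilinear_lsub[OF B] bilinear_rsub[OF B] bilinear_lmul[OF B] bilinear_rmul[OF B]
  define s where "s = B (q a) (q a)"
  define q' where "q' i = q i - (B (q i) (q a) / s) *\<^sub>R q a" for i
  have s0: "s \<ge> 0" using insert.prems[of "q a"]
    by (cases "q a = 0") (auto simp: s_def bilinear_lzero[OF B] span_base less_imp_le)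
  have "span (q' ` I) \<subseteq> span (q ` insert a I)"
  proof (rule span_minimal)
    show "q' ` I \<subseteq> span (q ` insert a I)"
      unfolding q'_def by (auto intro!: span_diff span_scale intro: span_base)
  qed simp
  then obtain w where w: "\<forall>i\<in>I. \<forall>j\<in>I. B (q' i) (q' j) = (\<Sum>k\<in>I. w i k * w j k)"
    using insert.IH[of q'] insert.prems by blast
  have z: "B x (q a) = s * (B x (q a) / s)" for x
  proof (cases "q a = 0")
    case False
    then have "s > 0" using insert.prems[of "q a"] by (simp add: s_def span_base)
    then show ?thesis by simp
  qed (simp add: bilinear_rzero[OF B])
  define v where "v i k = (if k = a then B (q i) (q a) / s * sqrt s else if i = a then 0 else w i k)" for i k
  have sum: "(\<Sum>k\<in>insert a I. v i k * v j k) = s * (B (q i) (q a) / s) * (B (q j) (q a) / s)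
      + (if i = a \<or> j = a then 0 else (\<Sum>k\<in>I. w i k * w j k))" for i j
  proof -
    have "(\<Sum>k\<in>I. v i k * v j k) = (if i = a \<or> j = a then 0 else (\<Sum>k\<in>I. w i k * w j k))"
      using insert.hyps(2) by (auto simp: v_def intro!: sum.cong sum.neutral)
    moreover have "v i a * v j a = s * (B (q i) (q a) / s) * (B (q j) (q a) / s)"
    proof -
      have "(x * sqrt s) * (y * sqrt s) = (sqrt s * sqrt s) * x * y" for x y by (simp only: mult_ac)
      then have "(x * sqrt s) * (y * sqrt s) = s * x * y" for x y using s0 by simp
      then show ?thesis unfolding v_def by (simp only: refl if_True)
    qed
    ultimately show ?thesis using insert.hyps by simp
  qed
  have "B (q i) (q j) = (\<Sum>k\<in>insert a I. v i k * v j k)" if "i \<in> insert a I" "j \<in> insert a I" for i j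
  proof -
    have d: "B (q i) (q j) = B (q' i) (q' j) + s * (B (q i) (q a) / s) * (B (q j) (q a) / s)"
    proof -
      define x y where "x = B (q i) (q a) / s" and "y = B (q j) (q a) / s"
      have "B (q i) (q a) = s * x" "B (q a) (q j) = s * y" using z sym[of "q a"] by (simp_all add: x_def y_def)
      then have "B (q' i) (q' j) = B (q i) (q j) - s * x * y"
        unfolding q'_def x_def[symmetric] y_def[symmetric] by (simp add: bil s_def[symmetric])
      then show ?thesis by (simp add: x_def y_def)
    qed
    have za: "B (q' i) (q' j) = 0" if "i = a \<or> j = a"
    proof -
      have "q' a = q a - (s / s) *\<^sub>R q a" by (simp add: q'_def s_def)
      moreover have "s = 0 \<Longrightarrow> q a = 0" using insert.prems[of "q a"] by (auto simp: s_def span_base)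
      ultimately have "q' a = 0" by (cases "s = 0") auto
      then show ?thesis using that by (auto simp: bilinear_lzero[OF B] bilinear_rzero[OF B])
    qed
    show ?thesis
    proof (cases "i = a \<or> j = a")
      case True
      then show ?thesis using d za sum[of i j] by simp
    next
      case False
      then have "i \<in> I" "j \<in> I" using that by auto
      then show ?thesis using d w sum[of i j] False by simp
    qed
  qed
  then show ?case by blast
qed simp

lemma gram_embedding:
  fixes q :: "'i \<Rightarrow> 'a::real_vector"
  assumes "finite I" "card I = CARD('n)" "bilinear B" "\<And>x y. B x y = B y x"
    and "\<And>p. p \<in> span (q ` I) \<Longrightarrow> p \<noteq> 0 \<Longrightarrow> B p p > (0::real)"
  shows "\<exists>u :: 'i \<Rightarrow> real^'n. \<forall>i\<in>I. \<forall>j\<in>I. u i \<bullet> u j = B (q i) (q j)"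
proof -
  obtain w where w: "\<forall>i\<in>I. \<forall>j\<in>I. B (q i) (q j) = (\<Sum>k\<in>I. w i k * w j (k::'i))"
    using gram_factorization[OF assms(1,3,4,5)] by blast
  obtain g where g: "bij_betw g (UNIV :: 'n set) I"
    using finite_same_card_bij[of "UNIV :: 'n set" I] assms(1,2) by auto
  have "(\<chi> k. w i (g k)) \<bullet> (\<chi> k. w j (g k)) = B (q i) (q j)" if "i \<in> I" "j \<in> I" for i j
    using w that sum.reindex_bij_betw[OF g, of "\<lambda>k. w i k * w j k"] by (simp add: inner_vec_def)
  then show ?thesis by (intro exI[of _ "\<lambda>i. \<chi> k. w i (g k)"]) blast
qed

text \<open>
  One more vector than the dimension fits into \<open>real^'n\<close> because a relation with nonzero last
  coefficient expresses the last vector by the others.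
\<close>

lemma gram_embedding_dependent:
  fixes q :: "nat \<Rightarrow> 'a::real_vector"
  assumes B: "bilinear B" and sym: "\<And>x y. B x y = B y x"
    and pos: "\<And>p. p \<in> span (q ` {1..CARD('n) + 1}) \<Longrightarrow> p \<noteq> 0 \<Longrightarrow> B p p > (0::real)"
    and c: "\<And>i. i \<in> {1..CARD('n) + 1} \<Longrightarrow> c i > 0" and cq: "(\<Sum>i=1..CARD('n) + 1. c i *\<^sub>R q i) = 0"
  shows "\<exists>u :: nat \<Rightarrow> real^'n. (\<Sum>i=1..CARD('n) + 1. c i *\<^sub>R u i) = 0 \<and>
    (\<forall>i\<in>{1..CARD('n) + 1}. \<forall>j\<in>{1..CARD('n) + 1}. u i \<bullet> u j = B (q i) (q j))"
proof -
  define N where "N = CARD('n) + 1"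
  define J where "J = {1..CARD('n)}"
  have IJ: "{1..N} = insert N J" and NJ: "N \<notin> J" and fJ: "finite J" by (auto simp: N_def J_def)
  note pos = pos[folded N_def] and c = c[folded N_def] and cq = cq[folded N_def]
  have cN: "c N > 0" using c by (simp add: N_def)
  have pos': "B p p > 0" if "p \<in> span (q ` J)" "p \<noteq> 0" for p
    using pos[of p] that span_mono[of "q ` J" "q ` {1..N}"] unfolding IJ by auto
  have cJ: "card J = CARD('n)" by (simp add: J_def)
  obtain v :: "nat \<Rightarrow> real^'n" where v: "\<forall>i\<in>J. \<forall>j\<in>J. v i \<bullet> v j = B (q i) (q j)"
    using gram_embedding[OF fJ cJ B sym pos'] by blast
  define d where "d i = - (c i / c N)" for i
  have "c N *\<^sub>R q N = - (\<Sum>i\<in>J. c i *\<^sub>R q i)"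
    using cq NJ fJ unfolding IJ by (simp add: eq_neg_iff_add_eq_0)
  then have "(1 / c N) *\<^sub>R (c N *\<^sub>R q N) = (\<Sum>i\<in>J. d i *\<^sub>R q i)"
    by (simp add: d_def scaleR_sum_right sum_negf)
  then have qN: "q N = (\<Sum>i\<in>J. d i *\<^sub>R q i)" using cN by simp
  define u where "u i = (if i = N then (\<Sum>i\<in>J. d i *\<^sub>R v i) else v i)" for i
  have uJ: "u i = v i" if "i \<in> J" for i using that NJ by (auto simp: u_def)
  have uN: "u N = (\<Sum>i\<in>J. d i *\<^sub>R v i)" by (simp add: u_def)
  have 1: "u i \<bullet> u N = B (q i) (q N)" if "i \<in> J" for i
    using that v by (simp add: uJ uN qN bilinear_sum_right[OF B] inner_sum_right)
  have 2: "u N \<bullet> u N = B (q N) (q N)"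
  proof -
    have "u N \<bullet> u N = (\<Sum>i\<in>J. d i * (u i \<bullet> u N))" by (subst uN) (simp add: inner_sum_left uJ)
    also have "\<dots> = (\<Sum>i\<in>J. d i * B (q i) (q N))" by (simp add: 1)
    also have "\<dots> = B (q N) (q N)"
      using arg_cong[OF qN, of "\<lambda>x. B x (q N)"] by (simp add: bilinear_sum_left[OF B])
    finally show ?thesis .
  qed
  have "(\<Sum>i\<in>J. c i *\<^sub>R u i) = - (c N *\<^sub>R u N)"
    using cN by (simp add: uN uJ d_def scaleR_sum_right sum_negf)
  then have "(\<Sum>i\<in>{1..N}. c i *\<^sub>R u i) = 0" using NJ fJ unfolding IJ by simp
  moreover have "u i \<bullet> u j = B (q i) (q j)" if "i \<in> {1..N}" "j \<in> {1..N}" for i j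
    using that 1 2 v uJ sym inner_commute unfolding IJ by (metis insertE)
  ultimately show ?thesis unfolding N_def by blast
qed

text \<open>
  The vectors \<open>q i\<close> become facet normals: embed them isometrically as \<open>u i\<close> in \<open>real^'n\<close>. The \<open>(u i, 1)\<close>
  are then linearly independent, since the only relation between the \<open>u i\<close> has nonzero coefficient
  sum, and their dual basis, scaled to height 1, gives the vertices.
\<close>

lemma euclidean_realization:
  fixes q :: "nat \<Rightarrow> 'a::real_vector"
  assumes n: "CARD('n) \<ge> 2" and B: "bilinear B" and sym: "\<And>x y. B x y = B y x"
    and pos: "\<And>p. p \<in> span (q ` {1..CARD('n) + 1}) \<Longrightarrow> p \<noteq> 0 \<Longrightarrow> B p p > (0::real)"
    and c: "\<And>i. i \<in> {1..CARD('n) + 1} \<Longrightarrow> c i > 0" and cq: "(\<Sum>i=1..CARD('n) + 1. c i *\<^sub>R q i) = 0"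
    and rel: "\<And>x. (\<Sum>i=1..CARD('n) + 1. x i *\<^sub>R q i) = 0 \<Longrightarrow> \<exists>t. \<forall>i\<in>{1..CARD('n) + 1}. x i = t * c i"
  shows "\<exists>E :: nat \<Rightarrow> real^'n. euclidean_simplex E \<and>
    (\<forall>i\<in>{1..CARD('n) + 1}. \<forall>j\<in>{1..CARD('n) + 1}. i \<noteq> j \<longrightarrow>
      euclidean_dihedral E i j = arccos (- cosine_wrt B (q i) (q j)) \<and> \<bar>cosine_wrt B (q i) (q j)\<bar> < 1)"
proof -
  define I where "I = {1..CARD('n) + 1}"
  have fI: "finite I" and cI: "card I = DIM((real^'n) \<times> real)" by (simp_all add: I_def)
  obtain u :: "nat \<Rightarrow> real^'n" where cu: "(\<Sum>i\<in>I. c i *\<^sub>R u i) = 0"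
    and u: "\<forall>i\<in>I. \<forall>j\<in>I. u i \<bullet> u j = B (q i) (q j)"
    using gram_embedding_dependent[OF B sym pos c cq] unfolding I_def by blast
  note pos = pos[folded I_def] and c = c[folded I_def] and rel = rel[folded I_def]
  define U where "U i = (u i, 1::real)" for i
  have sumc: "(\<Sum>i\<in>I. c i) > 0" by (rule sum_pos) (use c fI in \<open>auto simp: I_def\<close>)
  have coeff: "x k = 0" if x: "(\<Sum>i\<in>I. x i *\<^sub>R U i) = 0" and k: "k \<in> I" for x k
  proof -
    have xu: "(\<Sum>i\<in>I. x i *\<^sub>R u i) = 0" and x1: "(\<Sum>i\<in>I. x i) = 0"
      using arg_cong[OF x, of fst] arg_cong[OF x, of snd] by (simp_all add: U_def fst_sum snd_sum)
    let ?p = "\<Sum>i\<in>I. x i *\<^sub>R q i"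
    have "B ?p ?p = (\<Sum>i\<in>I. x i *\<^sub>R u i) \<bullet> (\<Sum>i\<in>I. x i *\<^sub>R u i)"
      by (simp add: bilinear_sum_left[OF B] bilinear_sum_right[OF B] inner_sum_left inner_sum_right u)
    then have "B ?p ?p = 0" by (simp add: xu)
    moreover have "?p \<in> span (q ` I)" by (intro span_sum span_scale span_base) auto
    ultimately have "?p = 0" using pos by force
    then obtain t where t: "\<forall>i\<in>I. x i = t * c i" using rel by blast
    then have "t * (\<Sum>i\<in>I. c i) = 0" using x1 by (simp add: sum_distrib_left)
    then show ?thesis using sumc t k by simp
  qed
  have "inj_on U I"
  proof (rule inj_onI, rule ccontr)
    fix i j assume ij: "i \<in> I" "j \<in> I" "U i = U j" "i \<noteq> j"
    define x where "x l = (if l = i then 1 else if l = j then - 1 else (0::real))" for l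
    have "(\<Sum>l\<in>I. x l *\<^sub>R U l) = (\<Sum>l\<in>{i, j}. x l *\<^sub>R U l)"
      by (rule sum.mono_neutral_right) (use fI ij in \<open>auto simp: x_def\<close>)
    also have "\<dots> = 0" using ij(3,4) by (simp add: x_def)
    finally show False using coeff[of x i] ij(1) by (simp add: x_def)
  qed
  moreover have "independent (U ` I)"
  proof (rule independent_if_scalars_zero)
    fix f y assume "(\<Sum>y\<in>U ` I. f y *\<^sub>R y) = 0" "y \<in> U ` I"
    then show "f y = 0" using coeff[of "\<lambda>i. f (U i)"] by (auto simp: sum.reindex[OF \<open>inj_on U I\<close>])
  qed (use fI in simp)
  ultimately have sp: "span (U ` I) = UNIV" by (rule spanning_if_independent_family[OF fI cI])
  have "a = 0" if a: "\<And>k. k \<in> I \<Longrightarrow> a \<bullet> U k = 0" for a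
  proof -
    have "a \<bullet> a = 0"
      using bilinear_zero_on_span[OF bilinear_inner, of "U ` I" a a] a sp by blast
    then show ?thesis by simp
  qed
  then have "\<exists>Z. \<forall>i\<in>I. \<forall>k\<in>I. Z i \<bullet> U k = (if i = k then 1 else 0)"
    by (rule dual_basis_exists[OF fI cI])
  then obtain Z where Z: "\<forall>i\<in>I. \<forall>k\<in>I. Z i \<bullet> U k = (if i = k then 1 else 0)" by blast
  have ZU: "facet_normals inner I Z U" unfolding facet_normals_def using Z by simp
  then have UZ: "facet_normals inner I U Z" using facet_normals_sym inner_commute by metis
  \<comment> \<open>The positive relation puts \<open>(0, 1)\<close> into the open cone over the \<open>U i\<close>, so all the dual
     vectors point upwards and can be scaled to height 1.\<close>
  have h: "snd (Z k) > 0" if k: "k \<in> I" for k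
  proof -
    have "(\<Sum>i\<in>I. c i *\<^sub>R U i) = (0, \<Sum>i\<in>I. c i)"
      using cu by (simp add: U_def prod_eq_iff fst_sum snd_sum)
    then have "(\<Sum>i\<in>I. c i) * snd (Z k) = c k * (U k \<bullet> Z k)"
      using facet_normals_combination[OF bilinear_inner fI UZ k, of c] by (simp add: inner_prod_def)
    also have "\<dots> > 0" using c[OF k] facet_normals_pos[OF UZ k] by simp
    finally show ?thesis using sumc by (simp add: zero_less_mult_iff)
  qed
  define E where "E k = (1 / snd (Z k)) *\<^sub>R fst (Z k)" for k
  have E: "(E k, 1) = (1 / snd (Z k)) *\<^sub>R Z k" if "k \<in> I" for k
    using h[OF that] by (simp add: E_def prod_eq_iff)
  have N: "facet_normals inner I U (\<lambda>k. (E k, 1::real))"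
    using UZ h unfolding facet_normals_def by (simp add: E)
  have "euclidean_simplex E" using N euclidean_simplex_iff unfolding I_def by blast
  moreover have "euclidean_dihedral E i j = arccos (- cosine_wrt B (q i) (q j)) \<and> \<bar>cosine_wrt B (q i) (q j)\<bar> < 1"
    if "i \<in> I" "j \<in> I" "i \<noteq> j" for i j
  proof -
    have "cosine_wrt inner (fst (U i)) (fst (U j)) = cosine_wrt B (q i) (q j)"
      using u that by (simp add: U_def cosine_wrt_def)
    then show ?thesis using euclidean_dihedral_eq[OF n N[unfolded I_def] that[unfolded I_def]] by simp
  qed
  ultimately show ?thesis unfolding I_def by blast
qed

section \<open>Rigidity of Euclidean dihedral angles\<close>

lemma arccos_minus_less:
  "x < y \<Longrightarrow> \<bar>x\<bar> < 1 \<Longrightarrow> \<bar>y\<bar> < 1 \<Longrightarrow> arccos (- x) < arccos (- y)"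
  by (subst arccos_less_mono) auto

lemma arccos_minus_le_iff:
  "\<bar>x\<bar> < 1 \<Longrightarrow> \<bar>y\<bar> < 1 \<Longrightarrow> arccos (- x) \<le> arccos (- y) \<longleftrightarrow> x \<le> y"
  by (subst arccos_le_mono) auto

lemma angles_lessI:
  assumes "n \<ge> 1" "\<And>i j. i \<in> {1..n + 1} \<Longrightarrow> j \<in> {1..n + 1} \<Longrightarrow> i \<noteq> j \<Longrightarrow> \<sigma> i j < \<tau> i j"
  shows "angles_less n \<sigma> \<tau>"
  unfolding angles_less_def angles_le_def
proof
  show "\<exists>i\<in>{1..n + 1}. \<exists>j\<in>{1..n + 1}. i \<noteq> j \<and> \<sigma> i j < \<tau> i j"
    by (intro bexI[of _ 1] bexI[of _ 2]) (use assms in auto)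
qed (use assms(2) less_imp_le in blast)

text \<open>
  The unit normals \<open>v\<^sub>i\<close> of the simplex with the larger angles satisfy \<open>\<Sum>\<^sub>i c\<^sub>i v\<^sub>i = 0\<close> with
  positive coefficients. Comparing the squared norms of the corresponding combinations of both systems of unit
  normals leaves no room for a strict inequality.
\<close>

lemma euclidean_angles_rigid:
  fixes E1 E2 :: "nat \<Rightarrow> real^'n"
  assumes n: "CARD('n) \<ge> 2" and E1: "euclidean_simplex E1" and E2: "euclidean_simplex E2"
    and le: "angles_le CARD('n) (euclidean_dihedral E1) (euclidean_dihedral E2)"
    and ij: "i \<in> {1..CARD('n) + 1}" "j \<in> {1..CARD('n) + 1}" "i \<noteq> j"
  shows "euclidean_dihedral E1 i j = euclidean_dihedral E2 i j"
proof -
  define I where "I = {1..CARD('n) + 1}"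
  have fI: "finite I" by (simp add: I_def)
  obtain U where U: "facet_normals inner {1..CARD('n) + 1} U (\<lambda>k. (E1 k, 1::real))"
    using E1 euclidean_simplex_iff by blast
  obtain V where V: "facet_normals inner {1..CARD('n) + 1} V (\<lambda>k. (E2 k, 1::real))"
    using E2 euclidean_simplex_iff by blast
  define G where "G i j = cosine_wrt inner (fst (U i)) (fst (U j))" for i j
  define H where "H i j = cosine_wrt inner (fst (V i)) (fst (V j))" for i j
  have nz: "fst (W i) \<noteq> 0" if "facet_normals inner {1..CARD('n) + 1} W (\<lambda>k. (E k, 1::real))" "i \<in> I"
    for W i and E :: "nat \<Rightarrow> real^'n"
  proof -
    obtain k where k: "k \<in> I" "k \<noteq> i" using third_index[OF n] unfolding I_def by metis
    show ?thesis
      using euclidean_normals_definite[OF n that(1) that(2)[unfolded I_def] k(1)[unfolded I_def] k(2)[symmetric], rule_format, of 1 0]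
      by auto
  qed
  have diag: "cosine_wrt inner u u = 1" if "u \<noteq> 0" for u :: "real^'n"
    using that by (simp add: cosine_wrt_def)
  have GH: "G i j \<le> H i j" if "i \<in> I" "j \<in> I" for i j
  proof (cases "i = j")
    case True
    then show ?thesis using nz[OF U that(1)] nz[OF V that(1)] by (simp add: G_def H_def diag)
  next
    case False
    note ij = that[unfolded I_def] False
    show ?thesis
      using le ij euclidean_dihedral_eq[OF n U ij] euclidean_dihedral_eq[OF n V ij]
        arccos_minus_le_iff[of "G i j" "H i j"]
      unfolding angles_le_def G_def H_def by force
  qed
  \<comment> \<open>Minkowski's relation: the unit normals weighted by the facet areas, which are
     inversely proportional to the heights, sum to zero.\<close>
  define c where "c i = norm (fst (V i)) / (V i \<bullet> (E2 i, 1))" for i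
  have cpos: "c i > 0" if "i \<in> I" for i
    using nz[OF V that] facet_normals_pos[OF V that[unfolded I_def]] by (simp add: c_def)
  define s where "s = (\<Sum>i\<in>I. (1 / (V i \<bullet> (E2 i, 1))) *\<^sub>R V i)"
  have "(s - (0, 1)) \<bullet> (E2 k, 1) = 0" if "k \<in> I" for k
    using facet_normals_combination[OF bilinear_inner fI V[folded I_def] that] facet_normals_pos[OF V that[unfolded I_def]]
    by (simp add: s_def inner_diff_left)
  then have "(s - (0, 1)) \<bullet> y = 0" for y
    using bilinear_zero_on_span[OF bilinear_inner, of "(\<lambda>k. (E2 k, 1::real)) ` I" "s - (0, 1)" y] lift_span[OF V]
    unfolding I_def by blast
  then have "s - (0, 1) = 0" using inner_eq_zero_iff by blast
  then have "fst s = 0" by (simp add: prod_eq_iff)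
  then have Vsum: "(\<Sum>i\<in>I. (c i / norm (fst (V i))) *\<^sub>R fst (V i)) = 0"
    using nz[OF V] by (simp add: s_def c_def fst_sum)
  have quad: "(\<Sum>i\<in>I. \<Sum>j\<in>I. c i * c j * cosine_wrt inner (w i) (w j)) =
      (\<Sum>i\<in>I. (c i / norm (w i)) *\<^sub>R w i) \<bullet> (\<Sum>i\<in>I. (c i / norm (w i)) *\<^sub>R w i)" for w :: "nat \<Rightarrow> real^'n"
    by (simp add: inner_sum_left inner_sum_right cosine_wrt_def norm_eq_sqrt_inner sum_distrib_left mult_ac)
      (simp add: inner_commute)
  have "(\<Sum>i\<in>I. \<Sum>j\<in>I. c i * c j * H i j) = 0" using quad[of "\<lambda>i. fst (V i)"] Vsum by (simp add: H_def)
  moreover have "(\<Sum>i\<in>I. \<Sum>j\<in>I. c i * c j * G i j) \<ge> 0" using quad[of "\<lambda>i. fst (U i)"] by (simp add: G_def)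
  ultimately have le0: "(\<Sum>i\<in>I. \<Sum>j\<in>I. c i * c j * (H i j - G i j)) \<le> 0"
    by (simp add: right_diff_distrib sum_subtractf)
  have nn: "c i * c j * (H i j - G i j) \<ge> 0" if "i \<in> I" "j \<in> I" for i j
    using GH[OF that] cpos that by (simp add: less_imp_le)
  have "(\<Sum>i\<in>I. \<Sum>j\<in>I. c i * c j * (H i j - G i j)) = 0"
    using le0 nn by (intro antisym sum_nonneg) auto
  then have "c i * c j * (H i j - G i j) = 0" if "i \<in> I" "j \<in> I" for i j
    using that nn fI by (simp add: sum_nonneg_eq_0_iff sum_nonneg) blast
  then have "G i j = H i j" using ij cpos unfolding I_def[symmetric] by (metis eq_iff_diff_eq_0 less_irrefl mult_eq_0_iff)
  then show ?thesis
    using euclidean_dihedral_eq(1)[OF n U ij] euclidean_dihedral_eq(1)[OF n V ij] by (simp add: G_def H_def)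
qed

section \<open>Comparing the geometries\<close>

lemma less_average_with_one:
  fixes g N :: real
  assumes "g < 1" "N > 0"
  shows "g < (g + N) / (1 + N)"
  using assms by (simp add: field_simps)

text \<open>
  The Euclidean normals are the projections of the hyperbolic unit normals to the spacelike complement
  of the incenter direction. As the incenter has equal distance to all facets, the projection adds the
  same constant to all products of unit normals.
\<close>

lemma euclidean_above_hyperbolic:
  fixes H :: "nat \<Rightarrow> (real^'n) \<times> real"
  assumes n: "CARD('n) \<ge> 2" and H: "hyperbolic_simplex H"
  shows "\<exists>E :: nat \<Rightarrow> real^'n. euclidean_simplex E \<and>
    angles_less CARD('n) (hyperbolic_dihedral H) (euclidean_dihedral E)"
proof -
  define I where "I = {1..CARD('n) + 1}"
  have fI: "finite I" and neI: "I \<noteq> {}" by (simp_all add: I_def)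
  have sum_neg: "sum f I < 0" if "\<And>i. i \<in> I \<Longrightarrow> f i < 0" for f :: "nat \<Rightarrow> real"
    using sum_strict_mono[OF fI neI that] by simp
  obtain U0 where HI: "H ` I \<subseteq> hyperbolic_space" and U0: "facet_normals lorentz I U0 H"
    using H unfolding hyperbolic_simplex_iff I_def by blast
  note L = bilinear_lorentz
  have sp: "span (H ` I) = UNIV"
    by (rule facet_normals_span[OF L fI _ U0]) (simp add: I_def)
  have U0pos: "lorentz (U0 i) (U0 i) > 0" if i: "i \<in> I" for i
  proof -
    obtain k where k: "k \<in> I" "k \<noteq> i" using third_index[OF n] unfolding I_def by metis
    have "U0 i \<noteq> 0" using facet_normals_pos[OF U0 i] by (auto simp: bilinear_lzero[OF L])
    moreover have "lorentz (H k) (H k) < 0" using HI k by (intro lorentz_neg_if_hyperbolic) auto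
    moreover have "lorentz (U0 i) (H k) = 0" using facet_normals_zero[OF U0 i k(1)] k(2) by simp
    ultimately show ?thesis using spacelike_if_orthogonal_to_timelike by blast
  qed
  define U where "U i = (1 / sqrt (lorentz (U0 i) (U0 i))) *\<^sub>R U0 i" for i
  have U: "facet_normals lorentz I U H"
    using facet_normals_scale[OF L U0, of "\<lambda>i. 1 / sqrt (lorentz (U0 i) (U0 i))" "\<lambda>_. 1"] U0pos
    by (simp add: U_def[abs_def])
  have unit: "lorentz (U i) (U i) = 1" if "i \<in> I" for i
    using U0pos[OF that] by (simp add: U_def bilinear_lmul[OF L] bilinear_rmul[OF L])
  define \<alpha> where "\<alpha> i = lorentz (U i) (H i)" for i
  have \<alpha>: "\<alpha> i > 0" if "i \<in> I" for i using facet_normals_pos[OF U that] by (simp add: \<alpha>_def)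
  \<comment> \<open>\<open>w\<close> points to the incenter: it has the same product with all unit normals.\<close>
  define w where "w = (\<Sum>k\<in>I. (1 / \<alpha> k) *\<^sub>R H k)"
  have wU: "lorentz w (U i) = 1" if i: "i \<in> I" for i
    using facet_normals_combination[OF L fI facet_normals_sym[OF U lorentz_sym] i, of "\<lambda>k. 1 / \<alpha> k"] \<alpha>[OF i]
    by (simp add: w_def \<alpha>_def lorentz_sym[of "H i"])
  have wH: "lorentz w (H k) < 0" if k: "k \<in> I" for k
    unfolding w_def bilinear_sum_left[OF L]
  proof (rule sum_neg)
    fix i assume "i \<in> I"
    moreover have "lorentz (H i) (H k) < 0"
      using lorentz_neg_if_hyperbolic HI k \<open>i \<in> I\<close> by blast
    ultimately show "1 / \<alpha> i * lorentz (H i) (H k) < 0" using \<alpha> by (simp add: divide_neg_pos)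
  qed
  define N where "N = - lorentz w w"
  have N: "N > 0"
  proof -
    have "lorentz w w = (\<Sum>k\<in>I. 1 / \<alpha> k * lorentz w (H k))"
      by (subst (2) w_def) (rule bilinear_sum_right[OF L])
    also have "\<dots> < 0"
      by (rule sum_neg) (use \<alpha> wH in \<open>auto simp: divide_neg_pos\<close>)
    finally show ?thesis by (simp add: N_def)
  qed
  define q where "q i = U i + (1 / N) *\<^sub>R w" for i
  note bil = bilinear_ladd[OF L] bilinear_radd[OF L] bilinear_lmul[OF L] bilinear_rmul[OF L]
  have Uw: "lorentz (U i) w = 1" if "i \<in> I" for i using wU[OF that] lorentz_sym by metis
  have ww: "lorentz w w = - N" by (simp add: N_def)
  have qw: "lorentz (q i) w = 0" if "i \<in> I" for i
    using N Uw[OF that] by (simp add: q_def bil ww)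
  have qq: "lorentz (q i) (q j) = lorentz (U i) (U j) + 1 / N" if "i \<in> I" "j \<in> I" for i j
    using N Uw[OF that(1)] wU[OF that(2)] by (simp add: q_def bil ww field_simps)
  have pos: "lorentz p p > 0" if p: "p \<in> span (q ` I)" "p \<noteq> 0" for p
  proof -
    have "lorentz w p = 0"
      by (rule bilinear_zero_on_span[OF L _ p(1)]) (use qw lorentz_sym in \<open>metis imageE\<close>)
    then have "lorentz p w = 0" using lorentz_sym by metis
    then show ?thesis using spacelike_if_orthogonal_to_timelike[of w p] p(2) N by (simp add: N_def)
  qed
  define c where "c k = - lorentz w (H k) / \<alpha> k" for k
  have c: "c k > 0" if "k \<in> I" for k using wH[OF that] \<alpha>[OF that] by (simp add: c_def divide_neg_pos)
  have cU: "(\<Sum>i\<in>I. c i *\<^sub>R U i) = - w"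
  proof -
    define e where "e = (\<Sum>i\<in>I. c i *\<^sub>R U i) + w"
    have "lorentz e (H k) = 0" if k: "k \<in> I" for k
    proof -
      have "lorentz e (H k) = c k * \<alpha> k + lorentz w (H k)"
        using facet_normals_combination[OF L fI U k, of c] by (simp only: e_def bil \<alpha>_def)
      then show ?thesis using \<alpha>[OF k] by (simp add: c_def)
    qed
    then have "\<And>z. z \<in> H ` I \<Longrightarrow> lorentz e z = 0" by blast
    then have "lorentz e y = 0" for y using bilinear_zero_on_span[OF L, of "H ` I" e y] sp by blast
    then have "e = 0" using lorentz_nondegenerate by blast
    then show ?thesis by (simp add: e_def eq_neg_iff_add_eq_0)
  qed
  have csum: "(\<Sum>i\<in>I. c i) = N"
  proof -
    have "(\<Sum>i\<in>I. c i) = (\<Sum>i\<in>I. c i * lorentz (U i) w)" using Uw by simp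
    also have "\<dots> = lorentz (- w) w" by (simp add: bilinear_sum_left[OF L] flip: cU)
    finally show ?thesis by (simp add: bilinear_lneg[OF L] N_def)
  qed
  have sumq: "(\<Sum>i\<in>I. x i *\<^sub>R q i) = (\<Sum>i\<in>I. x i *\<^sub>R U i) + ((\<Sum>i\<in>I. x i) / N) *\<^sub>R w" for x
    by (simp add: q_def scaleR_add_right sum.distrib sum_divide_distrib flip: scaleR_sum_left)
  have cq: "(\<Sum>i\<in>I. c i *\<^sub>R q i) = 0" using N by (simp add: sumq cU csum)
  have rel: "\<exists>t. \<forall>k\<in>I. x k = t * c k" if x: "(\<Sum>i\<in>I. x i *\<^sub>R q i) = 0" for x
  proof -
    define t where "t = (\<Sum>i\<in>I. x i) / N"
    have e: "(\<Sum>i\<in>I. x i *\<^sub>R U i) = (- t) *\<^sub>R w" using x unfolding sumq t_def by (simp add: eq_neg_iff_add_eq_0)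
    have "x k = t * c k" if k: "k \<in> I" for k
    proof -
      have "x k * \<alpha> k = (- t) * lorentz w (H k)"
        using facet_normals_combination[OF L fI U k, of x] unfolding e by (simp add: bil \<alpha>_def bilinear_lneg[OF L])
      then show ?thesis using \<alpha>[OF k] by (simp add: c_def field_simps)
    qed
    then show ?thesis by blast
  qed
  obtain E :: "nat \<Rightarrow> real^'n" where E: "euclidean_simplex E"
    and ang: "\<And>i j. i \<in> I \<Longrightarrow> j \<in> I \<Longrightarrow> i \<noteq> j \<Longrightarrow> euclidean_dihedral E i j = arccos (- cosine_wrt lorentz (q i) (q j))
      \<and> \<bar>cosine_wrt lorentz (q i) (q j)\<bar> < 1"
    using euclidean_realization[OF n L lorentz_sym pos[unfolded I_def] c[unfolded I_def] cq[unfolded I_def] rel[unfolded I_def]]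
    unfolding I_def by blast
  have "angles_less CARD('n) (hyperbolic_dihedral H) (euclidean_dihedral E)"
  proof (rule angles_lessI)
    fix i j assume "i \<in> {1..CARD('n) + 1}" "j \<in> {1..CARD('n) + 1}" and d: "i \<noteq> j"
    then have ij: "i \<in> I" "j \<in> I" by (simp_all add: I_def)
    note h = hyperbolic_dihedral_eq[OF n HI[unfolded I_def] U[unfolded I_def] ij[unfolded I_def] d]
    have cU: "cosine_wrt lorentz (U i) (U j) = lorentz (U i) (U j)" using ij by (simp add: cosine_wrt_def unit)
    have "cosine_wrt lorentz (q i) (q j) = (lorentz (U i) (U j) + 1 / N) / (1 + 1 / N)"
      using ij N by (simp add: cosine_wrt_def qq unit)
    also have "\<dots> > lorentz (U i) (U j)" by (rule less_average_with_one) (use h(2) N cU in auto)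
    finally show "hyperbolic_dihedral H i j < euclidean_dihedral E i j"
      using h ang[OF ij d] arccos_minus_less cU by simp
  qed (use n in simp)
  then show ?thesis using E by blast
qed

text \<open>
  With the incenter at the origin, both curved simplexes have facet normals whose
  \<open>real^'n\<close>-parts are the Euclidean unit normals, with one common last coordinate.
\<close>

lemma spherical_above_hyperbolic_below_euclidean:
  fixes E :: "nat \<Rightarrow> real^'n"
  assumes n: "CARD('n) \<ge> 2" and E: "euclidean_simplex E"
  shows "\<exists>(S :: nat \<Rightarrow> (real^'n) \<times> real) (H :: nat \<Rightarrow> (real^'n) \<times> real).
    spherical_simplex S \<and> hyperbolic_simplex H \<and>
    angles_less CARD('n) (hyperbolic_dihedral H) (euclidean_dihedral E) \<and>
    angles_less CARD('n) (euclidean_dihedral E) (spherical_dihedral S)"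
proof -
  define I where "I = {1..CARD('n) + 1}"
  have fI: "finite I" and neI: "I \<noteq> {}" by (simp_all add: I_def)
  obtain U0 where U0: "facet_normals inner I U0 (\<lambda>k. (E k, 1::real))"
    using E euclidean_simplex_iff unfolding I_def by blast
  have nz: "fst (U0 i) \<noteq> 0" if i: "i \<in> I" for i
  proof -
    obtain k where k: "k \<in> I" "k \<noteq> i" using third_index[OF n] unfolding I_def by metis
    show ?thesis
      using euclidean_normals_definite[OF n U0[unfolded I_def] i[unfolded I_def] k(1)[unfolded I_def] k(2)[symmetric], rule_format, of 1 0]
      by auto
  qed
  define U where "U i = (1 / norm (fst (U0 i))) *\<^sub>R U0 i" for i
  have U: "facet_normals inner I U (\<lambda>k. (E k, 1::real))"
    using facet_normals_scale[OF bilinear_inner U0, of "\<lambda>i. 1 / norm (fst (U0 i))" "\<lambda>_. 1"] nz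
    by (simp add: U_def[abs_def])
  define u where "u i = fst (U i)" for i
  have unit: "u i \<bullet> u i = 1" if "i \<in> I" for i
    using nz[OF that] by (simp add: u_def U_def dot_square_norm power2_eq_square)
  define \<alpha> where "\<alpha> i = U i \<bullet> (E i, 1)" for i
  have \<alpha>: "\<alpha> i > 0" if "i \<in> I" for i using facet_normals_pos[OF U that] by (simp add: \<alpha>_def)
  define r where "r = 1 / (\<Sum>i\<in>I. 1 / \<alpha> i)"
  have \<alpha>sum: "(\<Sum>i\<in>I. 1 / \<alpha> i) > 0" by (rule sum_pos) (use fI neI \<alpha> in auto)
  then have r: "r > 0" by (simp add: r_def)
  have "(\<Sum>i\<in>I. r / \<alpha> i) = r * (\<Sum>i\<in>I. 1 / \<alpha> i)" by (simp add: sum_distrib_left)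
  then have rsum: "(\<Sum>i\<in>I. r / \<alpha> i) = 1" using \<alpha>sum by (simp add: r_def)
  \<comment> \<open>\<open>p\<close> is the incenter and \<open>r\<close> the inradius.\<close>
  define p where "p = (\<Sum>k\<in>I. (r / \<alpha> k) *\<^sub>R E k)"
  have "(p, 1) = (\<Sum>k\<in>I. (r / \<alpha> k) *\<^sub>R (E k, 1::real))"
    using rsum by (simp add: p_def prod_eq_iff fst_sum snd_sum)
  then have Up: "U i \<bullet> (p, 1) = r" if "i \<in> I" for i
    using facet_normals_combination[OF bilinear_inner fI facet_normals_sym[OF U inner_commute] that, of "\<lambda>k. r / \<alpha> k"] \<alpha>[OF that]
    by (simp add: \<alpha>_def inner_commute)
  define x where "x k = E k - p" for k
  have ux: "u i \<bullet> x k + r = U i \<bullet> (E k, 1)" if "i \<in> I" for i k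
    using Up[OF that] by (simp add: u_def x_def inner_prod_def inner_diff_right)
  define G where "G i j = u i \<bullet> u j" for i j
  have eG: "euclidean_dihedral E i j = arccos (- G i j)" "\<bar>G i j\<bar> < 1" if "i \<in> I" "j \<in> I" "i \<noteq> j" for i j
    using euclidean_dihedral_eq[OF n U[unfolded I_def] that[unfolded I_def]] unit that
    by (simp_all add: cosine_wrt_def G_def u_def)

  define S where "S k = (1 / norm (x k, 1::real)) *\<^sub>R (x k, 1::real)" for k
  define V where "V i = (u i, r)" for i
  have pn: "norm (x k, 1::real) > 0" for k by (simp add: prod_eq_iff)
  have S: "facet_normals inner I V S"
  proof -
    have "facet_normals inner I V (\<lambda>k. (x k, 1))"
      using U unfolding facet_normals_def by (simp add: V_def ux)
    from facet_normals_scale[OF bilinear_inner this, of "\<lambda>_. 1" "\<lambda>k. 1 / norm (x k, 1::real)"] pn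
    show ?thesis by (simp add: S_def[abs_def])
  qed
  have "norm (S k) = 1" for k unfolding S_def norm_scaleR using pn[of k] by simp
  then have SI: "S ` I \<subseteq> unit_sphere" by (auto simp: unit_sphere_def)
  have "spherical_simplex S" using S SI spherical_simplex_iff unfolding I_def by blast
  moreover have "angles_less CARD('n) (euclidean_dihedral E) (spherical_dihedral S)"
  proof (rule angles_lessI)
    fix i j assume "i \<in> {1..CARD('n) + 1}" "j \<in> {1..CARD('n) + 1}" and d: "i \<noteq> j"
    then have ij: "i \<in> I" "j \<in> I" by (simp_all add: I_def)
    note h = spherical_dihedral_eq[OF S[unfolded I_def] ij[unfolded I_def] d]
    have "1 + r * r > 0" using r by (simp add: add_pos_pos)
    then have "cosine_wrt inner (V i) (V j) = (G i j + r * r) / (1 + r * r)"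
      using ij by (simp add: cosine_wrt_def V_def inner_prod_def unit G_def)
    also have "\<dots> > G i j" by (rule less_average_with_one) (use eG(2)[OF ij d] r in auto)
    finally show "euclidean_dihedral E i j < spherical_dihedral S i j"
      using h eG[OF ij d] arccos_minus_less by simp
  qed (use n in simp)
  moreover
  define t where "t = 1 / (1 + r + (\<Sum>k\<in>I. norm (x k)))"
  have den: "1 + r + (\<Sum>k\<in>I. norm (x k)) > 0" using r by (simp add: add_pos_nonneg sum_nonneg)
  have t: "t > 0" using den by (simp add: t_def)
  have tr: "t * r < 1" using den sum_nonneg[of I "\<lambda>k. norm (x k)"] by (simp add: t_def field_simps)
  have tx: "t * norm (x k) < 1" if "k \<in> I" for k
    using den r member_le_sum[OF that _ fI, of "\<lambda>k. norm (x k)"] by (simp add: t_def field_simps)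
  define \<delta> where "\<delta> k = 1 - (t * norm (x k)) * (t * norm (x k))" for k
  have \<delta>: "\<delta> k > 0" if "k \<in> I" for k
    using mult_strict_mono'[OF tx[OF that] tx[OF that]] t by (simp add: \<delta>_def)
  define H where "H k = (1 / sqrt (\<delta> k)) *\<^sub>R (t *\<^sub>R x k, 1::real)" for k
  define W where "W i = (u i, - (t * r))" for i
  have lWx: "lorentz (W i) (t *\<^sub>R x k, 1) = t * (U i \<bullet> (E k, 1))" if "i \<in> I" for i k
    by (simp add: W_def lorentz_def algebra_simps flip: ux[OF that])
  have W: "facet_normals lorentz I W H"
  proof -
    have "facet_normals lorentz I W (\<lambda>k. (t *\<^sub>R x k, 1))"
      using U t unfolding facet_normals_def by (simp add: lWx)
    from facet_normals_scale[OF bilinear_lorentz this, of "\<lambda>_. 1" "\<lambda>k. 1 / sqrt (\<delta> k)"] \<delta>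
    show ?thesis by (simp add: H_def[abs_def])
  qed
  have HI: "H ` I \<subseteq> hyperbolic_space"
  proof (rule image_subsetI)
    fix k assume k: "k \<in> I"
    have "lorentz (t *\<^sub>R x k, 1) (t *\<^sub>R x k, 1) = - \<delta> k"
      by (simp add: lorentz_def \<delta>_def dot_square_norm power2_eq_square algebra_simps)
    then have "lorentz (H k) (H k) = -1"
      using \<delta>[OF k] unfolding H_def bilinear_rmul[OF bilinear_lorentz] bilinear_lmul[OF bilinear_lorentz]
      by simp
    then show "H k \<in> hyperbolic_space" using \<delta>[OF k] by (simp add: hyperbolic_space_def H_def)
  qed
  have "hyperbolic_simplex H" using W HI hyperbolic_simplex_iff unfolding I_def by blast
  moreover have "angles_less CARD('n) (hyperbolic_dihedral H) (euclidean_dihedral E)"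
  proof (rule angles_lessI)
    fix i j assume "i \<in> {1..CARD('n) + 1}" "j \<in> {1..CARD('n) + 1}" and d: "i \<noteq> j"
    then have ij: "i \<in> I" "j \<in> I" by (simp_all add: I_def)
    note h = hyperbolic_dihedral_eq[OF n HI[unfolded I_def] W[unfolded I_def] ij[unfolded I_def] d]
    define \<rho> where "\<rho> = (t * r) * (t * r)"
    have \<rho>: "0 < \<rho>" "\<rho> < 1" using mult_strict_mono'[OF tr tr] t r by (simp_all add: \<rho>_def)
    then have "cosine_wrt lorentz (W i) (W j) = (G i j - \<rho>) / (1 - \<rho>)"
      using ij by (simp add: cosine_wrt_def W_def lorentz_def unit G_def \<rho>_def)
    also have "\<dots> < G i j"
    proof -
      have "\<rho> * G i j < \<rho> * 1" using \<rho> eG(2)[OF ij d] by (intro mult_strict_left_mono) auto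
      then show ?thesis using \<rho> by (simp add: field_simps)
    qed
    finally show "hyperbolic_dihedral H i j < euclidean_dihedral E i j"
      using h eG[OF ij d] arccos_minus_less by simp
  qed (use n in simp)
  ultimately show ?thesis by blast
qed

text \<open>
  For the point \<open>w\<close> of the convex hull nearest to the origin, \<open>w \<bullet> U i \<ge> \<parallel>w\<parallel>\<^sup>2\<close> and
  \<open>0 < \<parallel>w\<parallel> < 1\<close>, whence \<open>1 - w \<bullet> U i \<le> 1 - \<parallel>w\<parallel>\<^sup>2 < sqrt (1 - \<parallel>w\<parallel>\<^sup>2)\<close>. Some of its
  coefficients may vanish, but the strict inequalities survive a small perturbation that makes all
  of them positive.
\<close>

lemma exists_moebius_center:
  fixes U :: "nat \<Rightarrow> 'a::euclidean_space"
  assumes fI: "finite I" and N: "facet_normals inner I U Z"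
    and unit: "\<And>i. i \<in> I \<Longrightarrow> U i \<bullet> U i = 1" and kl: "k \<in> I" "l \<in> I" "k \<noteq> l"
  obtains y where "\<And>i. i \<in> I \<Longrightarrow> y i > (0::real)" "(\<Sum>i\<in>I. y i) = 1"
    "(\<Sum>i\<in>I. y i *\<^sub>R U i) \<bullet> (\<Sum>i\<in>I. y i *\<^sub>R U i) < 1"
    "\<And>i. i \<in> I \<Longrightarrow> 1 - (\<Sum>i\<in>I. y i *\<^sub>R U i) \<bullet> U i
       < sqrt (1 - (\<Sum>i\<in>I. y i *\<^sub>R U i) \<bullet> (\<Sum>i\<in>I. y i *\<^sub>R U i))"
proof -
  have inj: "inj_on U I" using facet_normals_inj_independent[OF bilinear_inner fI N] by blast
  define C where "C = convex hull (U ` I)"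
  define w where "w = closest_point C 0"
  have C: "convex C" "closed C" "C \<noteq> {}"
    using fI kl by (auto simp: C_def finite_imp_compact compact_convex_hull compact_imp_closed)
  have wC: "w \<in> C" unfolding w_def by (rule closest_point_in_set) (use C in auto)
  have wU: "w \<bullet> U i \<ge> w \<bullet> w" if "i \<in> I" for i
  proof -
    have "U i \<in> C" using that hull_inc[of "U i" "U ` I"] by (simp add: C_def)
    from closest_point_dot[OF C(1,2) this, of 0] show ?thesis by (simp add: w_def[symmetric] inner_diff_right)
  qed
  obtain v where v: "\<forall>x\<in>U ` I. 0 \<le> v x" "sum v (U ` I) = 1" "(\<Sum>x\<in>U ` I. v x *\<^sub>R x) = w"
    using wC fI unfolding C_def by (auto simp: convex_hull_finite)
  define y0 where "y0 i = v (U i)" for i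
  have y0: "y0 i \<ge> 0" if "i \<in> I" for i using v(1) that by (simp add: y0_def)
  have y0sum: "(\<Sum>i\<in>I. y0 i) = 1" and y0w: "(\<Sum>i\<in>I. y0 i *\<^sub>R U i) = w"
    using v(2,3) by (simp_all add: y0_def sum.reindex[OF inj])
  have "w \<noteq> 0"
  proof
    assume "w = 0"
    then have "y0 i = 0" if "i \<in> I" for i
      using facet_normals_imp_coeff_zero[OF bilinear_inner fI N _ that, of y0] y0w by simp
    then show False using y0sum by simp
  qed
  then have m0: "w \<bullet> w > 0" by simp
  have m1: "w \<bullet> w < 1"
  proof (rule ccontr)
    assume "\<not> w \<bullet> w < 1"
    then have "U i = w" if "i \<in> I" for i
    proof -
      have "(U i - w) \<bullet> (U i - w) \<le> 0"
        using wU[OF that] unit[OF that] \<open>\<not> w \<bullet> w < 1\<close> by (simp add: inner_diff_left inner_diff_right inner_commute)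
      then have "(U i - w) \<bullet> (U i - w) = 0" by (intro antisym inner_ge_zero)
      then show ?thesis by simp
    qed
    then have "U k = U l" using kl by metis
    then show False using inj kl by (auto dest: inj_onD)
  qed
  \<comment> \<open>Push the coefficients of \<open>w\<close> slightly towards the barycenter.\<close>
  define y where "y e i = (1 - e) * y0 i + e / card I" for e :: real and i
  define b where "b = (\<Sum>i\<in>I. (1 / card I) *\<^sub>R U i)"
  define w' where "w' e = (1 - e) *\<^sub>R w + e *\<^sub>R b" for e :: real
  have cI: "real (card I) > 0" using fI kl by (simp add: card_gt_0_iff) blast
  have yw: "(\<Sum>i\<in>I. y e i *\<^sub>R U i) = w' e" for e
    by (simp add: y_def w'_def b_def scaleR_add_left sum.distrib scaleR_sum_right flip: y0w)
  have lim: "(w' \<longlongrightarrow> w) (at_right 0)"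
    unfolding w'_def by (auto intro!: tendsto_eq_intros)
  have "\<forall>\<^sub>F e in at_right 0. w' e \<bullet> w' e < 1"
    by (rule order_tendstoD(2)[OF tendsto_inner[OF lim lim] m1])
  moreover have "\<forall>\<^sub>F e in at_right 0. \<forall>i\<in>I. sqrt (1 - w' e \<bullet> w' e) - (1 - w' e \<bullet> U i) > 0"
  proof (rule eventually_ball_finite[OF fI], rule ballI)
    fix i assume i: "i \<in> I"
    define s where "s = sqrt (1 - w \<bullet> w)"
    have s: "0 < s" "s < 1" "s * s = 1 - w \<bullet> w" using m0 m1 by (simp_all add: s_def)
    have "s * s < s * 1" by (rule mult_strict_left_mono) (use s in auto)
    then have "s - (1 - w \<bullet> U i) > 0" using wU[OF i] s(3) by simp
    moreover have "((\<lambda>e. sqrt (1 - w' e \<bullet> w' e) - (1 - w' e \<bullet> U i)) \<longlongrightarrow> s - (1 - w \<bullet> U i)) (at_right 0)"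
      unfolding s_def by (intro tendsto_intros lim)
    ultimately show "\<forall>\<^sub>F e in at_right 0. sqrt (1 - w' e \<bullet> w' e) - (1 - w' e \<bullet> U i) > 0"
      using order_tendstoD(1) by blast
  qed
  moreover have "\<forall>\<^sub>F e::real in at_right 0. e \<in> {0<..<1}" by (rule eventually_at_right_real) simp
  ultimately have "\<forall>\<^sub>F e in at_right 0. w' e \<bullet> w' e < 1 \<and>
      (\<forall>i\<in>I. sqrt (1 - w' e \<bullet> w' e) - (1 - w' e \<bullet> U i) > 0) \<and> e \<in> {0<..<1}"
    by (intro eventually_conj)
  then obtain e where e: "w' e \<bullet> w' e < 1" "\<forall>i\<in>I. sqrt (1 - w' e \<bullet> w' e) - (1 - w' e \<bullet> U i) > 0"
    "e \<in> {0<..<1}"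
    using eventually_happens'[OF trivial_limit_at_right_real] by blast
  show ?thesis
  proof (rule that[of "y e"])
    show "y e i > 0" if "i \<in> I" for i
      using y0[OF that] e(3) cI by (simp add: y_def add_nonneg_pos)
    show "(\<Sum>i\<in>I. y e i) = 1"
      using y0sum cI by (simp add: y_def sum.distrib flip: sum_distrib_left)
  qed (use e in \<open>auto simp: yw\<close>)
qed

text \<open>
  The Moebius transformation moving \<open>w\<close> to the center sends \<open>U i\<close> to \<open>T (U i - w) / \<nu> i\<close>, where the
  linear map \<open>T\<close> fixes \<open>w\<close> and multiplies the complement of \<open>w\<close> by \<open>sqrt (1 - m)\<close> with
  \<open>m = \<parallel>w\<parallel>\<^sup>2\<close>. The form \<open>B\<close> in the proof is \<open>B p q = T p \<bullet> T q\<close>, and the factors \<open>1 / \<nu> i\<close> do not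
  affect angles.
\<close>

lemma euclidean_below_spherical:
  fixes S :: "nat \<Rightarrow> (real^'n) \<times> real"
  assumes n: "CARD('n) \<ge> 2" and S: "spherical_simplex S"
  shows "\<exists>E :: nat \<Rightarrow> real^'n. euclidean_simplex E \<and>
    angles_less CARD('n) (euclidean_dihedral E) (spherical_dihedral S)"
proof -
  define I where "I = {1..CARD('n) + 1}"
  have fI: "finite I" by (simp add: I_def)
  obtain U0 where U0: "facet_normals inner I U0 S"
    using S unfolding spherical_simplex_iff I_def by blast
  define U where "U i = (1 / norm (U0 i)) *\<^sub>R U0 i" for i
  have U0nz: "U0 i \<noteq> 0" if "i \<in> I" for i using facet_normals_pos[OF U0 that] by auto
  have U: "facet_normals inner I U S"
    using facet_normals_scale[OF bilinear_inner U0, of "\<lambda>i. 1 / norm (U0 i)" "\<lambda>_. 1"] U0nz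
    by (simp add: U_def[abs_def])
  have unit: "U i \<bullet> U i = 1" if "i \<in> I" for i
    using U0nz[OF that] by (simp add: U_def dot_square_norm power2_eq_square)
  have 12: "1 \<in> I" "2 \<in> I" "1 \<noteq> (2::nat)" using n by (auto simp: I_def)
  obtain y where y: "\<And>i. i \<in> I \<Longrightarrow> y i > (0::real)" "(\<Sum>i\<in>I. y i) = 1"
    "(\<Sum>i\<in>I. y i *\<^sub>R U i) \<bullet> (\<Sum>i\<in>I. y i *\<^sub>R U i) < 1"
    "\<And>i. i \<in> I \<Longrightarrow> 1 - (\<Sum>i\<in>I. y i *\<^sub>R U i) \<bullet> U i
       < sqrt (1 - (\<Sum>i\<in>I. y i *\<^sub>R U i) \<bullet> (\<Sum>i\<in>I. y i *\<^sub>R U i))"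
    using exists_moebius_center[OF fI U unit 12] by blast
  define w where "w = (\<Sum>i\<in>I. y i *\<^sub>R U i)"
  define m where "m = w \<bullet> w"
  have m: "m < 1" using y(3) by (simp add: m_def w_def)
  define \<nu> where "\<nu> i = 1 - w \<bullet> U i" for i
  have \<nu>lt: "\<nu> i < sqrt (1 - m)" if "i \<in> I" for i using y(4)[OF that] by (simp add: \<nu>_def m_def w_def)
  have \<nu>pos: "\<nu> i > 0" if "i \<in> I" for i
  proof -
    have "w \<bullet> U i \<le> norm w * norm (U i)" by (rule norm_cauchy_schwarz)
    also have "\<dots> = norm w" using unit[OF that] by (simp add: norm_eq_sqrt_inner)
    also have "\<dots> < 1" using m by (simp add: m_def norm_eq_sqrt_inner)
    finally show ?thesis by (simp add: \<nu>_def)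
  qed
  define B where "B p q = (1 - m) * (p \<bullet> q) + (w \<bullet> p) * (w \<bullet> q)" for p q
  have B: "bilinear B"
    by (auto simp: bilinear_def linear_iff B_def inner_add_left inner_add_right algebra_simps)
  have sym: "B p q = B q p" for p q by (simp add: B_def inner_commute)
  have pos: "B p p > 0" if "p \<noteq> 0" for p
    using that m by (simp add: B_def add_pos_nonneg)
  define q where "q i = U i - w" for i
  have qq: "B (q i) (q j) = \<nu> i * \<nu> j - (1 - m) * (1 - U i \<bullet> U j)" for i j
  proof -
    have 1: "(U i - w) \<bullet> (U j - w) = U i \<bullet> U j - w \<bullet> U i - w \<bullet> U j + m"
      by (simp add: inner_diff_left inner_diff_right m_def inner_commute)
    have 2: "w \<bullet> (U l - w) = w \<bullet> U l - m" for l by (simp add: inner_diff_right m_def)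
    show ?thesis unfolding B_def q_def 1 2 \<nu>_def by algebra
  qed
  have sumq: "(\<Sum>i\<in>I. x i *\<^sub>R q i) = (\<Sum>i\<in>I. (x i - (\<Sum>i\<in>I. x i) * y i) *\<^sub>R U i)" for x
  proof -
    have "(\<Sum>i\<in>I. x i *\<^sub>R q i) = (\<Sum>i\<in>I. x i *\<^sub>R U i) - (\<Sum>i\<in>I. x i) *\<^sub>R w"
      by (simp add: q_def scaleR_diff_right sum_subtractf flip: scaleR_sum_left)
    also have "\<dots> = (\<Sum>i\<in>I. (x i - (\<Sum>i\<in>I. x i) * y i) *\<^sub>R U i)"
      by (simp add: w_def scaleR_diff_left sum_subtractf scaleR_sum_right)
    finally show ?thesis .
  qed
  have cq: "(\<Sum>i\<in>I. y i *\<^sub>R q i) = 0" unfolding sumq y(2) by simp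
  have rel: "\<exists>t. \<forall>i\<in>I. x i = t * y i" if "(\<Sum>i\<in>I. x i *\<^sub>R q i) = 0" for x
  proof -
    have "x k - (\<Sum>i\<in>I. x i) * y k = 0" if "k \<in> I" for k
      using facet_normals_imp_coeff_zero[OF bilinear_inner fI U _ that, of "\<lambda>i. x i - (\<Sum>i\<in>I. x i) * y i"]
        \<open>(\<Sum>i\<in>I. x i *\<^sub>R q i) = 0\<close> unfolding sumq by blast
    then show ?thesis by (intro exI[of _ "\<Sum>i\<in>I. x i"]) auto
  qed
  obtain E :: "nat \<Rightarrow> real^'n" where E: "euclidean_simplex E"
    and ang: "\<And>i j. i \<in> I \<Longrightarrow> j \<in> I \<Longrightarrow> i \<noteq> j \<Longrightarrow> euclidean_dihedral E i j = arccos (- cosine_wrt B (q i) (q j))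
      \<and> \<bar>cosine_wrt B (q i) (q j)\<bar> < 1"
    using euclidean_realization[OF n B sym pos y(1)[unfolded I_def] cq[unfolded I_def] rel[unfolded I_def]]
    unfolding I_def by blast
  have "angles_less CARD('n) (euclidean_dihedral E) (spherical_dihedral S)"
  proof (rule angles_lessI)
    fix i j assume "i \<in> {1..CARD('n) + 1}" "j \<in> {1..CARD('n) + 1}" and d: "i \<noteq> j"
    then have ij: "i \<in> I" "j \<in> I" by (simp_all add: I_def)
    note h = spherical_dihedral_eq[OF U[unfolded I_def] ij[unfolded I_def] d]
    have cU: "cosine_wrt inner (U i) (U j) = U i \<bullet> U j" using ij by (simp add: cosine_wrt_def unit)
    have nn: "sqrt (B (q k) (q k)) = \<nu> k" if "k \<in> I" for k
      using \<nu>pos[OF that] by (simp add: qq unit[OF that])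
    have \<nu>\<nu>: "0 < \<nu> i * \<nu> j" using \<nu>pos ij by simp
    have "\<nu> i * \<nu> j < sqrt (1 - m) * sqrt (1 - m)"
      by (rule mult_strict_mono') (use \<nu>pos \<nu>lt ij less_imp_le in auto)
    then have "\<nu> i * \<nu> j * (1 - U i \<bullet> U j) < (1 - m) * (1 - U i \<bullet> U j)"
      using m h(2) cU by (intro mult_strict_right_mono) auto
    moreover have "cosine_wrt B (q i) (q j) = (\<nu> i * \<nu> j - (1 - m) * (1 - U i \<bullet> U j)) / (\<nu> i * \<nu> j)"
      using ij by (simp add: cosine_wrt_def nn) (simp add: qq)
    ultimately have "cosine_wrt B (q i) (q j) < U i \<bullet> U j"
      using \<nu>\<nu> by (simp add: divide_less_eq algebra_simps)
    then show "euclidean_dihedral E i j < spherical_dihedral S i j"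
      using h ang[OF ij d] arccos_minus_less cU by simp
  qed (use n in simp)
  then show ?thesis using E by blast
qed

theorem mainTheorem1:
  assumes "CARD('n::finite) \<ge> 2"
  shows
    "(\<forall>S :: nat \<Rightarrow> (real^'n) \<times> real. spherical_simplex S \<longrightarrow>
        (\<exists>E :: nat \<Rightarrow> real^'n. euclidean_simplex E \<and>
           angles_less CARD('n) (euclidean_dihedral E) (spherical_dihedral S)))
   \<and> (\<forall>H :: nat \<Rightarrow> (real^'n) \<times> real. hyperbolic_simplex H \<longrightarrow>
        (\<exists>E :: nat \<Rightarrow> real^'n. euclidean_simplex E \<and>
           angles_less CARD('n) (hyperbolic_dihedral H) (euclidean_dihedral E)))
   \<and> (\<forall>E :: nat \<Rightarrow> real^'n. euclidean_simplex E \<longrightarrow>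
        (\<exists>(S :: nat \<Rightarrow> (real^'n) \<times> real) (H :: nat \<Rightarrow> (real^'n) \<times> real).
           spherical_simplex S \<and> hyperbolic_simplex H \<and>
           angles_less CARD('n) (hyperbolic_dihedral H) (euclidean_dihedral E) \<and>
           angles_less CARD('n) (euclidean_dihedral E) (spherical_dihedral S)))
   \<and> (\<forall>(E1 :: nat \<Rightarrow> real^'n) (E2 :: nat \<Rightarrow> real^'n).
        euclidean_simplex E1 \<and> euclidean_simplex E2 \<and>
        angles_le CARD('n) (euclidean_dihedral E1) (euclidean_dihedral E2) \<longrightarrow>
        (\<forall>i\<in>{1..CARD('n) + 1}. \<forall>j\<in>{1..CARD('n) + 1}. i \<noteq> j \<longrightarrow>
           euclidean_dihedral E1 i j = euclidean_dihedral E2 i j))"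
  using euclidean_below_spherical[OF assms] euclidean_above_hyperbolic[OF assms]
    spherical_above_hyperbolic_below_euclidean[OF assms] euclidean_angles_rigid[OF assms]
  by (intro conjI allI impI ballI) blast+

end
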